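(* The deformation space of the ideal tridymite framework is singular in a neighbourhood of the aristotype, and, in such a neighbourhood, it can be represented as a ramified covering with four sheets of a three-dimensional domain. There is a natural $\mathbb{Z}_2\times\mathbb{Z}_2$ action on this covering which fixes the aristotype framework.
   Context: Periodic frameworks and deformations. A 3-periodic bar-and-joint framework is an infinite graph with a free action of a free abelian group $\Gamma$ of rank 3 (with finitely many orbits of vertices and edges), realized in $\mathbb{R}^3$ so that $\Gamma$ acts on the vertices by a rank 3 lattice of translations. A deformation keeps all edge lengths fixed and keeps the framework periodic under the abstract group $\Gamma$, but the lattice of translations representing $\Gamma$ may vary. Deformations are considered modulo Euclidean motions, and no condition of non-self-collision is imposed. The ideal tridymite framework. It consists of congruent regular tetrahedra (all six edges are bars), each vertex being shared by exactly two tetrahedra. The quotient graph has 8 vertices and 24 edges. Modulo $\Gamma$ there are four tetrahedra, represented by $OD_1E_1O_1$, $O_1A_1B_1C_1$, $OD_2E_2O_2$, $O_2A_2B_2C_2$ (sharing the vertices $O$, $O_1$, $O_2$ as indicated by the names). The periods $A_2-A_1$, $B_2-B_1$, $C_2-C_1$, $D_2-D_1$, $E_2-E_1$ generate the periodicity lattice and are subject to the two relations $$(C_2-C_1)+(D_2-D_1)=A_2-A_1,\qquad (C_2-C_1)+(E_2-E_1)=B_2-B_1 .$$ Parametrization. Take $O$ as the origin and keep the tetrahedron $OD_1E_1O_1$ fixed, with $O_1=f_0$, $D_1=f_1$, $E_1=f_2$. All configurations are described by three orthogonal matrices $R_0,R_1,R_2$, via $$O_2=R_0f_0,\quad D_2=R_0f_1,\quad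 E_2=R_0f_2,$$ $$A_1=f_0+R_1(f_1-f_0),\quad B_1=f_0+R_1(f_2-f_0),\quad C_1=f_0-R_1f_0,$$ $$A_2=R_0f_0+R_2R_0(f_1-f_0),\quad B_2=R_0f_0+R_2R_0(f_2-f_0),\quad C_2=R_0f_0-R_2R_0f_0 .$$ The two relations between the periods then become $$(I-R_0-R_1+R_2R_0)f_i=0,\qquad i=1,2.$$ The aristotype (ideal high tridymite) is the configuration $R_0=-I$, $R_1=R_2=$ the reflection in the plane $\mathrm{span}(f_1,f_2)$. The deformation space in a neighbourhood of the aristotype is the set of triples $(R_0,R_1,R_2)$ of orthogonal matrices near the aristotype satisfying the equations $(I-R_0-R_1+R_2R_0)f_i=0$, $i=1,2$. Equivalently, put $Q=-R_0$, $Q_1=R_1$, $Q_2=-R_2R_0$, so that $Q,-Q_1,-Q_2\in SO(3)$, and let $e_1,e_2$ be an orthonormal basis of $\mathrm{span}(f_1,f_2)$; the equations become $$e_i+Qe_i=Q_1e_i+Q_2e_i,\qquad i=1,2,$$ with $Q$ near the identity in $SO(3)$. Meaning of the terms in the claim. - "Singular in a neighbourhood of the aristotype" means that the germ at the aristotype of the real algebraic set of triples $(Q,Q_1,Q_2)$ with $Q,-Q_1,-Q_2\in SO(3)$ defined by the equations $e_i+Qe_i=Q_1e_i+Q_2e_i$, $i=1,2$, is not smooth (the solution space of the linearized equations has dimension larger than the local dimension). - The ramified covering is the projection $(Q,Q_1,Q_2)\mapsto Q$ onto a neighbourhood of the identity in $SO(3)$ (the three-dimensional domain); "ramified covering with four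 sheets" means that the fibre over a generic $Q$ has exactly four points. - The natural $\mathbb{Z}_2\times\mathbb{Z}_2$ action preserves the fibres of this projection and is generated by two commuting involutions: the relabeling $(Q,Q_1,Q_2)\mapsto(Q,Q_2,Q_1)$, and the reflection which, for given $Q$, replaces each $Q_ke_i$ by $r\,Q_ke_i$ ($k,i\in\{1,2\}$), where $r$ is the reflection of $\mathbb{R}^3$ in the plane spanned by $M_1,M_2$ and $M_i$ is the midpoint of the short geodesic arc $[e_i,Qe_i]$ on the unit sphere. Here $Q_1,Q_2$, being orthogonal with determinant $-1$, are determined by their values on $e_1,e_2$. *)

theory Defs
  imports "HOL-Analysis.Analysis" "HOL-Algebra.Group_Action" "HOL-Algebra.Elementary_Groups"
begin

section \<open>The ideal tridymite framework\<close>

definition regular_tetrahedron :: "real^3 \<Rightarrow> real^3 \<Rightarrow> real^3 \<Rightarrow> real^3 \<Rightarrow> bool" where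
  "regular_tetrahedron a b c d \<longleftrightarrow>
     (\<exists>l>0. dist a b = l \<and> dist a c = l \<and> dist a d = l \<and> dist b c = l \<and> dist b d = l \<and> dist c d = l)"

type_synonym matrix_triple = "(real^3^3) \<times> (real^3^3) \<times> (real^3^3)"

text \<open>
  The tetrahedron with vertices \<open>0 = O\<close>, \<open>f0 = O1\<close>, \<open>f1 = D1\<close>, \<open>f2 = E1\<close> is held fixed, which
  eliminates the Euclidean motions.  A triple of orthogonal matrices places the tetrahedra
  \<open>O D2 E2 O2\<close>, \<open>O1 A1 B1 C1\<close>, \<open>O2 A2 B2 C2\<close>; the differences \<open>A2 - A1\<close>, ..., \<open>E2 - E1\<close> are the
  periods, and the only conditions left are the two linear relations between them.
\<close>

definition deformation_space :: "real^3 \<Rightarrow> real^3 \<Rightarrow> real^3 \<Rightarrow> matrix_triple set" where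
  "deformation_space f0 f1 f2 =
     {(R0, R1, R2). orthogonal_matrix R0 \<and> orthogonal_matrix R1 \<and> orthogonal_matrix R2 \<and>
       (let O1 = f0; D1 = f1; E1 = f2;
            O2 = R0 *v f0; D2 = R0 *v f1; E2 = R0 *v f2;
            A1 = O1 + R1 *v (f1 - f0); B1 = O1 + R1 *v (f2 - f0); C1 = O1 - R1 *v f0;
            A2 = O2 + (R2 ** R0) *v (f1 - f0); B2 = O2 + (R2 ** R0) *v (f2 - f0);
            C2 = O2 - (R2 ** R0) *v f0
        in (C2 - C1) + (D2 - D1) = A2 - A1 \<and> (C2 - C1) + (E2 - E1) = B2 - B1)}"

lemma deformation_space_eq:
  "deformation_space f0 f1 f2 =
     {(R0, R1, R2). orthogonal_matrix R0 \<and> orthogonal_matrix R1 \<and> orthogonal_matrix R2 \<and>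
        (\<forall>f\<in>{f1, f2}. (mat 1 - R0 - R1 + R2 ** R0) *v f = 0)}"
proof -
  have *: "((R0 *v f0 - (R2 ** R0) *v f0) - (f0 - R1 *v f0) + (R0 *v f - f) =
        (R0 *v f0 + (R2 ** R0) *v (f - f0)) - (f0 + R1 *v (f - f0))) \<longleftrightarrow>
      (mat 1 - R0 - R1 + R2 ** R0) *v f = 0" for R0 R1 R2 :: "real^3^3" and f :: "real^3"
    by (auto simp: matrix_vector_mult_add_rdistrib matrix_vector_mult_diff_rdistrib
        matrix_vector_mult_diff_distrib algebra_simps)
  show ?thesis
    unfolding deformation_space_def Let_def * by auto
qed

text \<open>Reflection in the plane spanned by two linearly independent vectors, via its normal.\<close>

definition plane_reflection :: "real^3 \<Rightarrow> real^3 \<Rightarrow> real^3^3" where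
  "plane_reflection u v =
     (let n = cross3 u v in matrix (\<lambda>x. x - (2 * (x \<bullet> n) / (n \<bullet> n)) *\<^sub>R n))"

definition aristotype :: "real^3 \<Rightarrow> real^3 \<Rightarrow> matrix_triple" where
  "aristotype f1 f2 = (- mat 1, plane_reflection f1 f2, plane_reflection f1 f2)"


section \<open>The coordinates \<open>Q = - R0\<close>, \<open>Q1 = R1\<close>, \<open>Q2 = - R2 R0\<close>\<close>

definition to_Q :: "matrix_triple \<Rightarrow> matrix_triple" where
  "to_Q = (\<lambda>(R0, R1, R2). (- R0, R1, - (R2 ** R0)))"

definition from_Q :: "matrix_triple \<Rightarrow> matrix_triple" where
  "from_Q = (\<lambda>(Q, Q1, Q2). (- Q, Q1, Q2 ** transpose Q))"

definition SO3 :: "(real^3^3) set" where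
  "SO3 = {A. orthogonal_matrix A \<and> det A = 1}"

definition Q_space :: "real^3 \<Rightarrow> real^3 \<Rightarrow> matrix_triple set" where
  "Q_space e1 e2 =
     {(Q, Q1, Q2). Q \<in> SO3 \<and> - Q1 \<in> SO3 \<and> - Q2 \<in> SO3 \<and>
        (\<forall>e\<in>{e1, e2}. e + Q *v e = Q1 *v e + Q2 *v e)}"

definition Q_aristotype :: "real^3 \<Rightarrow> real^3 \<Rightarrow> matrix_triple" where
  "Q_aristotype e1 e2 = (mat 1, plane_reflection e1 e2, plane_reflection e1 e2)"

text \<open>The polynomial equations cutting out \<^term>\<open>Q_space e1 e2\<close>, as a single map.\<close>

definition SO3_equations :: "real^3^3 \<Rightarrow> (real^3^3) \<times> real" where
  "SO3_equations A = (transpose A ** A - mat 1, det A - 1)"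

definition Q_equations :: "real^3 \<Rightarrow> real^3 \<Rightarrow> matrix_triple \<Rightarrow>
    ((real^3^3) \<times> real) \<times> ((real^3^3) \<times> real) \<times> ((real^3^3) \<times> real) \<times> (real^3) \<times> (real^3)" where
  "Q_equations e1 e2 = (\<lambda>(Q, Q1, Q2).
     (SO3_equations Q, SO3_equations (- Q1), SO3_equations (- Q2),
      e1 + Q *v e1 - (Q1 *v e1 + Q2 *v e1), e2 + Q *v e2 - (Q1 *v e2 + Q2 *v e2)))"

lemma Q_space_eq_zeros: "Q_space e1 e2 = {x. Q_equations e1 e2 x = 0}"
  by (auto simp: Q_space_def Q_equations_def SO3_equations_def SO3_def orthogonal_matrix zero_prod_def)


section \<open>Smoothness and local dimension of germs\<close>

text \<open>
  Infinite differentiability on an open set: the function is differentiable and all its directional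
  derivatives are again infinitely differentiable.
\<close>

coinductive smooth_on :: "'a::real_normed_vector set \<Rightarrow> ('a \<Rightarrow> 'b::real_normed_vector) \<Rightarrow> bool"
  for S where
  "(\<forall>x\<in>S. f differentiable (at x)) \<Longrightarrow>
   (\<forall>v. smooth_on S (\<lambda>x. frechet_derivative f (at x) v)) \<Longrightarrow> smooth_on S f"

text \<open>\<open>X\<close> is an embedded smooth submanifold near \<open>p\<close>: a diffeomorphism flattens it.\<close>

definition smooth_germ :: "'a::euclidean_space set \<Rightarrow> 'a \<Rightarrow> bool" where
  "smooth_germ X p \<longleftrightarrow>
     (\<exists>N (\<phi> :: 'a \<Rightarrow> 'a) \<psi> L. open N \<and> p \<in> N \<and> open (\<phi> ` N) \<and>
        smooth_on N \<phi> \<and> smooth_on (\<phi> ` N) \<psi> \<and> (\<forall>x\<in>N. \<psi> (\<phi> x) = x) \<and>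
        subspace L \<and> \<phi> ` (X \<inter> N) = \<phi> ` N \<inter> L)"

text \<open>
  The dimension of a semialgebraic set is the largest \<open>d\<close> for which it contains a \<open>d\<close>-cell, a subset
  homeomorphic to a \<open>d\<close>-dimensional real vector space; the local dimension at a point is the
  dimension of the intersection with small neighbourhoods.
\<close>

definition local_dim :: "'a::euclidean_space set \<Rightarrow> 'a \<Rightarrow> nat" where
  "local_dim X p =
     (GREATEST d. \<forall>N. open N \<and> p \<in> N \<longrightarrow>
        (\<exists>S (T :: 'a set). S \<subseteq> X \<inter> N \<and> subspace T \<and> dim T = d \<and> S homeomorphic T))"


section \<open>Ramified coverings\<close>

text \<open>
  A finite-sheeted ramified covering: a proper surjection which is a covering with \<open>n\<close> sheets over an
  open dense set of generic points, no part of \<open>W\<close> lying entirely over the remaining points.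
\<close>

definition ramified_covering ::
    "'a::topological_space set \<Rightarrow> ('a \<Rightarrow> 'b::topological_space) \<Rightarrow> 'b set \<Rightarrow> nat \<Rightarrow> bool" where
  "ramified_covering W p U n \<longleftrightarrow>
     continuous_on W p \<and> p ` W = U \<and> proper_map (top_of_set W) (top_of_set U) p \<and>
     (\<exists>V. openin (top_of_set U) V \<and> U \<subseteq> closure V \<and> W \<subseteq> closure (W \<inter> p -` V) \<and>
        covering_space (W \<inter> p -` V) p V \<and> (\<forall>q\<in>V. card {x \<in> W. p x = q} = n))"


section \<open>The action of \<open>Z2 x Z2\<close>\<close>

definition relabel :: "matrix_triple \<Rightarrow> matrix_triple" where
  "relabel = (\<lambda>(Q, Q1, Q2). (Q, Q2, Q1))"

text \<open>Midpoint of the short geodesic arc joining two non-antipodal points of the unit sphere.\<close>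

definition arc_midpoint :: "real^3 \<Rightarrow> real^3 \<Rightarrow> real^3" where
  "arc_midpoint a b = sgn (a + b)"

text \<open>
  The orthogonal matrix of determinant \<open>-1\<close> with prescribed values on the orthonormal vectors
  \<open>e1\<close>, \<open>e2\<close>; it exists and is unique when these values are orthonormal.
\<close>

definition improper_extension :: "real^3 \<Rightarrow> real^3 \<Rightarrow> real^3 \<Rightarrow> real^3 \<Rightarrow> real^3^3" where
  "improper_extension e1 e2 a1 a2 = (THE P. - P \<in> SO3 \<and> P *v e1 = a1 \<and> P *v e2 = a2)"

definition reflect :: "real^3 \<Rightarrow> real^3 \<Rightarrow> matrix_triple \<Rightarrow> matrix_triple" where
  "reflect e1 e2 = (\<lambda>(Q, Q1, Q2).
     let r = plane_reflection (arc_midpoint e1 (Q *v e1)) (arc_midpoint e2 (Q *v e2)) in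
       (Q, improper_extension e1 e2 (r *v (Q1 *v e1)) (r *v (Q1 *v e2)),
           improper_extension e1 e2 (r *v (Q2 *v e1)) (r *v (Q2 *v e2))))"

text \<open>
  The group \<open>Z2\<close> has carrier \<open>{0, 1}\<close>; the generators act by relabeling and by reflection.
  Actions on \<open>W\<close> consist of extensional functions, hence the restriction to \<open>W\<close>.
\<close>

abbreviation Z2xZ2 :: "(int \<times> int) monoid" where
  "Z2xZ2 \<equiv> integer_mod_group 2 \<times>\<times> integer_mod_group 2"

definition natural_action ::
    "real^3 \<Rightarrow> real^3 \<Rightarrow> matrix_triple set \<Rightarrow> int \<times> int \<Rightarrow> matrix_triple \<Rightarrow> matrix_triple" where
  "natural_action e1 e2 W = (\<lambda>(a, b). \<lambda>x\<in>W. (relabel ^^ nat a) ((reflect e1 e2 ^^ nat b) x))"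

end

theory Submission
  imports Defs
begin

text \<open>
  Put \<open>w\<^sub>i = e\<^sub>i + Q e\<^sub>i\<close>.  A point of \<open>Q_space e1 e2\<close> over \<open>Q\<close> is a way to write the pair \<open>(w\<^sub>1, w\<^sub>2)\<close>
  as a sum of two orthonormal pairs: the pairs \<open>Q\<^sub>1 e\<^sub>i\<close> and \<open>Q\<^sub>2 e\<^sub>i\<close>, each of which determines an
  orthogonal matrix of determinant \<open>-1\<close>.  One such decomposition is \<open>(e\<^sub>1, e\<^sub>2)\<close> plus
  \<open>(Q e\<^sub>1, Q e\<^sub>2)\<close>; exchanging the summands, and reflecting them in the plane of \<open>w\<^sub>1, w\<^sub>2\<close>, gives
  three more.  There are no others if \<open>w\<^sub>1, w\<^sub>2\<close> are independent (\<open>pairs_with_equal_gram\<close>,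
  \<open>orthonormal_pairs_with_equal_sums\<close>): the conditions prescribe the Gram matrix of the half
  differences \<open>h\<^sub>i\<close> of the summands and make \<open>(w\<^sub>i \<bullet> h\<^sub>j)\<close> skew.  The components of the \<open>h\<^sub>i\<close> in the plane
  of \<open>w\<^sub>1, w\<^sub>2\<close> are then fixed up to a common factor, and comparing the definite form which
  they contribute to the Gram matrix with the rank one form contributed by the normal components fixes
  both up to one sign each.

  With \<open>\<rho>\<close> the reflection in the plane of \<open>e\<^sub>1, e\<^sub>2\<close> and \<open>r\<close> the one in the plane of
  \<open>w\<^sub>1, w\<^sub>2\<close>, the fibre over \<open>Q\<close> consists of
  \<open>(Q, \<rho>, Q \<rho>)\<close>, \<open>(Q, Q \<rho>, \<rho>)\<close>, \<open>(Q, r, r Q)\<close> and \<open>(Q, r Q, r)\<close> (\<open>Q_space_fibre\<close>).  So the space is, over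
  the rotations \<open>Q\<close> without eigenvalue \<open>-1\<close>, a union of four graphs of continuous functions of \<open>Q\<close>, which
  are permuted simply transitively by relabeling and reflection.  In Cayley's rational
  parametrization of these rotations by vectors \<open>g\<close> of \<open>\<real>\<^sup>3\<close>, the normal of \<open>w\<^sub>1, w\<^sub>2\<close> is
  proportional to \<open>e\<^sub>3 + g \<times> e\<^sub>3\<close> with \<open>e\<^sub>3 = e\<^sub>1 \<times> e\<^sub>2\<close>, from which one reads off that the four graphs are disjoint outside a nowhere
  dense set (\<open>sheets_distinct\<close>).  This gives the ramified covering and the faithful action.

  Singularity follows by counting dimensions.  The four graphs are closed and each
  is parametrized by three coordinates, so by invariance of domain a cell contained in their union
  has dimension at most 3 (\<open>dim_sheet_patch_le_3\<close>).  On the other hand the tangent spaces at the aristotype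
  of the first two graphs already span a space of dimension 6.  This space is annihilated by the
  linearized equations, and the derivative of a flattening diffeomorphism would map it injectively
  into a space of dimension at most 3.
\<close>

section \<open>Orthogonal matrices and reflections\<close>

lemma continuous_on_matrix_matrix_mult [continuous_intros]:
  fixes A B :: "'a::topological_space \<Rightarrow> real^3^3"
  assumes "continuous_on S A" "continuous_on S B"
  shows "continuous_on S (\<lambda>x. A x ** B x)"
  unfolding matrix_matrix_mult_def by (intro continuous_intros assms)

lemma continuous_on_matrix_vector_mult [continuous_intros]:
  fixes A :: "'a::topological_space \<Rightarrow> real^3^3"
  assumes "continuous_on S A" "continuous_on S v"
  shows "continuous_on S (\<lambda>x. A x *v v x)"
  unfolding matrix_vector_mult_def by (intro continuous_intros assms)

lemma continuous_on_transpose [continuous_intros]: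
  fixes A :: "'a::topological_space \<Rightarrow> real^3^3"
  assumes "continuous_on S A"
  shows "continuous_on S (\<lambda>x. transpose (A x))"
  unfolding transpose_def by (intro continuous_intros assms)

lemma continuous_on_det [continuous_intros]:
  fixes A :: "'a::topological_space \<Rightarrow> real^3^3"
  assumes "continuous_on S A"
  shows "continuous_on S (\<lambda>x. det (A x))"
  unfolding det_3 by (intro continuous_intros assms)

lemma matrix_eqI:
  fixes A B :: "real^3^3"
  assumes "\<And>x. A *v x = B *v x"
  shows "A = B"
  using assms by (simp add: matrix_eq)

lemma SO3_transpose_mult: "Q \<in> SO3 \<Longrightarrow> transpose Q ** Q = mat 1"
  by (simp add: SO3_def orthogonal_matrix)

lemma orthogonal_matrix_inner:
  fixes A :: "real^3^3"
  assumes "orthogonal_matrix A"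
  shows "(A *v x) \<bullet> (A *v y) = x \<bullet> y"
  by (metis assms dot_lmul_matrix matrix_vector_mul_assoc matrix_vector_mul_lid orthogonal_matrix
      transpose_matrix_vector)

lemma orthogonal_matrix_iff_inner:
  fixes A :: "real^3^3"
  shows "orthogonal_matrix A \<longleftrightarrow> (\<forall>x y. (A *v x) \<bullet> (A *v y) = x \<bullet> y)"
proof
  assume "\<forall>x y. (A *v x) \<bullet> (A *v y) = x \<bullet> y"
  then have "orthogonal_transformation ((*v) A)"
    by (simp add: orthogonal_transformation_def)
  then show "orthogonal_matrix A"
    by (simp add: orthogonal_transformation_matrix)
qed (simp add: orthogonal_matrix_inner)

lemma uminus_matrix_vector_mult: "(- A) *v x = - (A *v x)" for A :: "real^3^3"
  by (simp add: matrix_vector_mult_def vec_eq_iff sum_negf)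

lemma det_uminus_3: "det (- A) = - det (A :: real^3^3)"
  by (simp add: det_3 algebra_simps)

lemma orthogonal_matrix_uminus [simp]:
  "orthogonal_matrix (- A) \<longleftrightarrow> orthogonal_matrix (A :: real^3^3)"
  by (simp add: orthogonal_matrix_iff_inner uminus_matrix_vector_mult)

lemma uminus_SO3_iff: "- A \<in> SO3 \<longleftrightarrow> orthogonal_matrix A \<and> det A = - 1"
  by (auto simp: SO3_def det_uminus_3)

lemma SO3_inner: "Q \<in> SO3 \<Longrightarrow> (Q *v x) \<bullet> (Q *v y) = x \<bullet> y"
  by (simp add: SO3_def orthogonal_matrix_inner)

lemma
  shows SO3_mult_improper: "A \<in> SO3 \<Longrightarrow> - B \<in> SO3 \<Longrightarrow> - (A ** B) \<in> SO3"
    and improper_mult_SO3: "- A \<in> SO3 \<Longrightarrow> B \<in> SO3 \<Longrightarrow> - (A ** B) \<in> SO3"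
    and improper_mult_improper: "- A \<in> SO3 \<Longrightarrow> - B \<in> SO3 \<Longrightarrow> A ** B \<in> SO3"
  unfolding uminus_SO3_iff by (auto simp: SO3_def orthogonal_matrix_mul det_mul)

definition reflection :: "real^3 \<Rightarrow> real^3^3" where
  "reflection n = matrix (\<lambda>x. x - (2 * (x \<bullet> n) / (n \<bullet> n)) *\<^sub>R n)"

lemma plane_reflection_eq: "plane_reflection u v = reflection (cross3 u v)"
  by (simp add: plane_reflection_def reflection_def Let_def)

lemma reflection_apply: "reflection n *v x = x - (2 * (x \<bullet> n) / (n \<bullet> n)) *\<^sub>R n"
proof -
  have "linear (\<lambda>x. x - (2 * (x \<bullet> n) / (n \<bullet> n)) *\<^sub>R n)"
    by (rule linearI) (simp_all add: algebra_simps add_divide_distrib)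
  then show ?thesis
    unfolding reflection_def by (simp add: matrix_works)
qed

lemma reflection_scale: "c \<noteq> 0 \<Longrightarrow> reflection (c *\<^sub>R n) = reflection n"
  by (rule matrix_eqI) (cases "n = 0", auto simp: reflection_apply)

lemma reflection_fixes: "x \<bullet> n = 0 \<Longrightarrow> reflection n *v x = x"
  by (simp add: reflection_apply)

lemma reflection_inner: "n \<noteq> 0 \<Longrightarrow> (reflection n *v x) \<bullet> (reflection n *v y) = x \<bullet> y"
  by (simp add: reflection_apply algebra_simps inner_commute)

lemma reflection_inner_right: "n \<noteq> 0 \<Longrightarrow> (reflection n *v x) \<bullet> n = - (x \<bullet> n)"
  by (simp add: reflection_apply inner_diff_left)

lemma reflection_involution: "n \<noteq> 0 \<Longrightarrow> reflection n ** reflection n = mat 1"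
proof (rule matrix_eqI)
  fix x :: "real^3"
  assume "n \<noteq> 0"
  then have "reflection n *v (reflection n *v x) = x"
    by (subst reflection_apply) (simp add: reflection_inner_right, simp add: reflection_apply)
  then show "(reflection n ** reflection n) *v x = mat 1 *v x"
    by (simp flip: matrix_vector_mul_assoc)
qed

lemma reflection_improper:
  assumes "n \<noteq> 0"
  shows "- reflection n \<in> SO3"
proof -
  have "n$1 * n$1 + n$2 * n$2 + n$3 * n$3 \<noteq> 0"
    using assms inner_eq_zero_iff[of n] by (simp add: inner_vec_def sum_3)
  then have "det (reflection n) = - 1"
    unfolding reflection_def matrix_def det_3
    by (simp add: axis_def inner_vec_def sum_3 divide_simps) algebra
  moreover have "orthogonal_matrix (reflection n)"
    by (simp add: orthogonal_matrix_iff_inner reflection_inner assms)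
  ultimately show ?thesis
    by (simp add: uminus_SO3_iff)
qed

lemma continuous_on_reflection [continuous_intros]:
  fixes n :: "'a::topological_space \<Rightarrow> real^3"
  assumes "continuous_on S n" "\<And>x. x \<in> S \<Longrightarrow> n x \<noteq> 0"
  shows "continuous_on S (\<lambda>x. reflection (n x))"
  unfolding reflection_def matrix_def
  by (intro continuous_intros assms) (simp add: assms)

section \<open>Splitting two vectors into orthonormal pairs\<close>

text \<open>
  The inner product of \<open>\<real>\<^sup>3\<close> in terms of the products with \<open>m\<^sub>1\<close>, \<open>m\<^sub>2\<close> and their normal \<open>n\<close>:
  the plane part is the inverse of the Gram matrix of \<open>m\<^sub>1, m\<^sub>2\<close>, whose determinant is \<open>n \<bullet> n\<close>.
\<close>
lemma inner_adapted_frame: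
  fixes m1 m2 x y :: "real^3"
  defines "n \<equiv> cross3 m1 m2"
  shows "(n \<bullet> n) * (x \<bullet> y) = (x \<bullet> n) * (y \<bullet> n) + (m2 \<bullet> m2) * (x \<bullet> m1) * (y \<bullet> m1)
    - (m1 \<bullet> m2) * ((x \<bullet> m1) * (y \<bullet> m2) + (x \<bullet> m2) * (y \<bullet> m1)) + (m1 \<bullet> m1) * (x \<bullet> m2) * (y \<bullet> m2)"
  unfolding n_def cross3_def by (simp add: inner_vec_def sum_3) algebra

lemma eq_if_same_inner_adapted_frame:
  fixes m1 m2 x y :: "real^3"
  assumes "cross3 m1 m2 \<noteq> 0"
    and "x \<bullet> m1 = y \<bullet> m1" "x \<bullet> m2 = y \<bullet> m2" "x \<bullet> cross3 m1 m2 = y \<bullet> cross3 m1 m2"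
  shows "x = y"
proof -
  have "(x - y) \<bullet> m1 = 0" "(x - y) \<bullet> m2 = 0" "(x - y) \<bullet> cross3 m1 m2 = 0"
    using assms by (simp_all add: inner_diff_left)
  then have "(cross3 m1 m2 \<bullet> cross3 m1 m2) * ((x - y) \<bullet> (x - y)) = 0"
    by (simp only: inner_adapted_frame) simp
  then show ?thesis
    using assms by simp
qed

text \<open>
  In the frame \<open>m\<^sub>1, m\<^sub>2, n\<close> skewness leaves three coordinates for the pair \<open>h\<close>: the number
  \<open>a = m\<^sub>1 \<bullet> h\<^sub>2\<close> and the normal coordinates \<open>t\<^sub>1, t\<^sub>2\<close>; let \<open>b\<close> and \<open>s\<^sub>1, s\<^sub>2\<close> be those of \<open>d\<close>.  Equality of the
  Gram matrices says that \<open>(a\<^sup>2 - b\<^sup>2) G = s s\<^sup>T - t t\<^sup>T\<close> with \<open>G\<close> the Gram matrix of \<open>m\<^sub>1, m\<^sub>2\<close>.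
  The determinant of the left side is nonnegative and that of the right side is \<open>-(s\<^sub>1 t\<^sub>2 - s\<^sub>2 t\<^sub>1)\<^sup>2\<close>, so both
  sides vanish, \<open>a = \<plusminus> b\<close> and \<open>t = \<plusminus> s\<close>.  Changing the sign of \<open>t\<close> is the reflection.
\<close>
lemma pairs_with_equal_gram:
  fixes m1 m2 h1 h2 d1 d2 :: "real^3"
  defines "n \<equiv> cross3 m1 m2"
  assumes n: "n \<noteq> 0"
    and h: "m1 \<bullet> h1 = 0" "m2 \<bullet> h2 = 0" "m1 \<bullet> h2 + m2 \<bullet> h1 = 0"
    and d: "m1 \<bullet> d1 = 0" "m2 \<bullet> d2 = 0" "m1 \<bullet> d2 + m2 \<bullet> d1 = 0"
    and gram: "h1 \<bullet> h1 = d1 \<bullet> d1" "h1 \<bullet> h2 = d1 \<bullet> d2" "h2 \<bullet> h2 = d2 \<bullet> d2"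
  shows "(h1 = d1 \<and> h2 = d2) \<or> (h1 = - d1 \<and> h2 = - d2) \<or>
    (h1 = reflection n *v d1 \<and> h2 = reflection n *v d2) \<or>
    (h1 = - (reflection n *v d1) \<and> h2 = - (reflection n *v d2))"
proof -
  define A B C where "A = m1 \<bullet> m1" and "B = m2 \<bullet> m2" and "C = m1 \<bullet> m2"
  define s1 s2 t1 t2 a b where "s1 = d1 \<bullet> n" and "s2 = d2 \<bullet> n" and "t1 = h1 \<bullet> n" and "t2 = h2 \<bullet> n"
    and "a = h2 \<bullet> m1" and "b = d2 \<bullet> m1"
  note defs = A_def B_def C_def s1_def s2_def t1_def t2_def a_def b_def
  have h': "h1 \<bullet> m1 = 0" "h2 \<bullet> m2 = 0" "h1 \<bullet> m2 = - a"
    and d': "d1 \<bullet> m1 = 0" "d2 \<bullet> m2 = 0" "d1 \<bullet> m2 = - b"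
    using h d by (simp_all add: defs inner_commute)
  note frame = inner_adapted_frame[of m1 m2, folded n_def]
  have 1: "t1 * t1 + A * (a * a) = s1 * s1 + A * (b * b)"
    using frame[of h1 h1] frame[of d1 d1] gram by (simp add: h' d' flip: defs)
  have 2: "t2 * t2 + B * (a * a) = s2 * s2 + B * (b * b)"
    using frame[of h2 h2] frame[of d2 d2] gram by (simp add: h' d' flip: defs)
  have 3: "t1 * t2 + C * (a * a) = s1 * s2 + C * (b * b)"
    using frame[of h1 h2] frame[of d1 d2] gram by (simp add: h' d' flip: defs)
  have "A * B - C * C = n \<bullet> n"
    unfolding defs n_def by (simp add: cross3_def inner_vec_def sum_3 algebra_simps)
  then have pos: "A * B - C * C > 0"
    using n by simp
  have "(A * B - C * C) * (a * a - b * b)\<^sup>2 = - (s1 * t2 - s2 * t1)\<^sup>2"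
    using 1 2 3 by algebra
  then have "(A * B - C * C) * (a * a - b * b)\<^sup>2 \<le> 0"
    by simp
  then have ab: "a * a = b * b"
    using pos by (simp add: mult_le_0_iff)
  have st: "t1 * t1 = s1 * s1" "t2 * t2 = s2 * s2" "t1 * t2 = s1 * s2"
    using 1 2 3 ab by simp_all
  have a_cases: "a = b \<or> a = - b"
    using ab square_eq_iff by blast
  have t_cases: "t1 = s1 \<and> t2 = s2 \<or> t1 = - s1 \<and> t2 = - s2"
    using st by (metis minus_mult_minus mult_cancel_left mult_eq_0_iff mult_minus_left square_eq_iff
        neg_equal_0_iff_equal)
  have eqI: "x = y" if "x \<bullet> m1 = y \<bullet> m1" "x \<bullet> m2 = y \<bullet> m2" "x \<bullet> n = y \<bullet> n" for x y
    using eq_if_same_inner_adapted_frame[of m1 m2 x y] n that by (simp add: n_def)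
  have mn: "m1 \<bullet> n = 0" "m2 \<bullet> n = 0" "n \<bullet> m1 = 0" "n \<bullet> m2 = 0"
    by (simp_all add: n_def dot_cross_self)
  have r: "(reflection n *v x) \<bullet> m1 = x \<bullet> m1" "(reflection n *v x) \<bullet> m2 = x \<bullet> m2" for x
    by (simp_all add: reflection_apply inner_diff_left mn)
  note rn = reflection_inner_right[OF n]
  consider "a = b" "t1 = s1" "t2 = s2" | "a = b" "t1 = - s1" "t2 = - s2"
    | "a = - b" "t1 = s1" "t2 = s2" | "a = - b" "t1 = - s1" "t2 = - s2"
    using a_cases t_cases by blast
  then show ?thesis
  proof cases
    case 1
    have "h1 = d1" "h2 = d2"
      by (rule eqI; use 1 h' d' in \<open>simp flip: defs\<close>)+
    then show ?thesis by simp
  next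
    case 2
    have "h1 = reflection n *v d1" "h2 = reflection n *v d2"
      by (rule eqI; use 2 h' d' in \<open>simp add: r rn flip: defs\<close>)+
    then show ?thesis by simp
  next
    case 3
    have "h1 = - (reflection n *v d1)" "h2 = - (reflection n *v d2)"
      by (rule eqI; use 3 h' d' in \<open>simp add: r rn flip: defs\<close>)+
    then show ?thesis by simp
  next
    case 4
    have "h1 = - d1" "h2 = - d2"
      by (rule eqI; use 4 h' d' in \<open>simp flip: defs\<close>)+
    then show ?thesis by simp
  qed
qed

section \<open>The Cayley parametrization of rotations\<close>

definition cross_matrix :: "real^3 \<Rightarrow> real^3^3" where
  "cross_matrix g = matrix (cross3 g)"

text \<open>
  The Cayley transform \<open>(1 + A) (1 - A)\<^sup>-\<^sup>1\<close> of \<open>A = cross_matrix g\<close>, with the inverse worked out: the rotation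
  about the axis \<open>g\<close> whose half angle has tangent \<open>norm g\<close>.
\<close>
definition cayley :: "real^3 \<Rightarrow> real^3^3" where
  "cayley g = (1 / (1 + g \<bullet> g)) *\<^sub>R
     ((1 - g \<bullet> g) *\<^sub>R mat 1 + 2 *\<^sub>R matrix (\<lambda>x. (g \<bullet> x) *\<^sub>R g) + 2 *\<^sub>R cross_matrix g)"

text \<open>
  Where it inverts \<open>cayley\<close>, this is the axis of the rotation \<open>Q\<close> scaled to the tangent of half the angle.
\<close>
definition gibbs_vector :: "real^3^3 \<Rightarrow> real^3" where
  "gibbs_vector Q = (1 / (1 + trace Q)) *\<^sub>R
     vector [Q$3$2 - Q$2$3, Q$1$3 - Q$3$1, Q$2$1 - Q$1$2]"

text \<open>
  The rotations which are not half turns; these are the Cayley transforms.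
\<close>
definition cayley_rotations :: "(real^3^3) set" where
  "cayley_rotations = {Q \<in> SO3. det (mat 1 + Q) \<noteq> 0}"

lemma cross_matrix_apply: "cross_matrix g *v x = cross3 g x"
proof -
  have "linear (cross3 g)"
    by (rule linearI) (simp_all add: cross_add_right cross_mult_right)
  then show ?thesis
    by (simp add: cross_matrix_def matrix_works)
qed

lemma cross_matrix_scale: "cross_matrix (c *\<^sub>R g) = c *\<^sub>R cross_matrix g"
  by (rule matrix_eqI)
    (simp add: cross_matrix_apply cross_mult_left flip: scaleR_matrix_vector_assoc)

lemma one_plus_inner_pos: "0 < 1 + g \<bullet> g" for g :: "real^3"
  using inner_ge_zero[of g] by linarith

lemma cayley_apply:
  "cayley g *v x = (1 / (1 + g \<bullet> g)) *\<^sub>R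
     ((1 - g \<bullet> g) *\<^sub>R x + (2 * (g \<bullet> x)) *\<^sub>R g + 2 *\<^sub>R cross3 g x)"
proof -
  have "linear (\<lambda>x. (g \<bullet> x) *\<^sub>R g)"
    by (rule linearI) (simp_all add: algebra_simps)
  then have "matrix (\<lambda>x. (g \<bullet> x) *\<^sub>R g) *v x = (g \<bullet> x) *\<^sub>R g"
    by (simp add: matrix_works)
  then show ?thesis
    unfolding cayley_def
    by (simp add: matrix_vector_mult_add_rdistrib cross_matrix_apply flip: scaleR_matrix_vector_assoc)
qed

text \<open>
  The identity \<open>Q (1 - A) = 1 + A\<close>, which by \<open>diff_cross_surj\<close> characterizes \<open>Q\<close>.  Later
  arguments use it in place of the explicit entries.
\<close>
lemma cayley_transform: "cayley g *v (x - cross3 g x) = x + cross3 g x"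
proof -
  have 1: "cross3 g (x - cross3 g x) = cross3 g x - ((g \<bullet> x) *\<^sub>R g - (g \<bullet> g) *\<^sub>R x)"
    by (simp add: Cross3.right_diff_distrib Lagrange)
  have 2: "g \<bullet> (x - cross3 g x) = g \<bullet> x"
    by (simp add: inner_diff_right dot_cross_self)
  have "(1 - g \<bullet> g) *\<^sub>R (x - cross3 g x) + (2 * (g \<bullet> (x - cross3 g x))) *\<^sub>R g
      + 2 *\<^sub>R cross3 g (x - cross3 g x) = (1 + g \<bullet> g) *\<^sub>R (x + cross3 g x)"
    unfolding 1 2 vec_eq_iff by (simp add: algebra_simps)
  then show ?thesis
    using one_plus_inner_pos[of g] by (simp add: cayley_apply)
qed

lemma diff_cross_surj:
  obtains x' where "x = x' - cross3 g x'"
proof -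
  let ?f = "\<lambda>x. x - cross3 g x"
  have "linear ?f"
    by (rule linearI) (simp_all add: cross_add_right cross_mult_right algebra_simps)
  moreover have "inj ?f"
    unfolding linear_injective_0[OF \<open>linear ?f\<close>]
  proof (intro allI impI)
    fix x assume "?f x = 0"
    then have "x \<bullet> ?f x = 0" by simp
    then show "x = 0"
      by (simp add: inner_diff_right dot_cross_self)
  qed
  ultimately have "surj ?f"
    by (simp add: linear_injective_imp_surjective)
  then show ?thesis
    using that by (metis surjD)
qed

lemma cayley_unique:
  assumes "\<And>x. Q *v (x - cross3 g x) = x + cross3 g x"
  shows "Q = cayley g"
  by (rule matrix_eqI) (metis assms cayley_transform diff_cross_surj)

lemma cayley_inner: "(cayley g *v x) \<bullet> (cayley g *v y) = x \<bullet> y"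
proof -
  obtain x' where x: "x = x' - cross3 g x'" by (rule diff_cross_surj)
  obtain y' where y: "y = y' - cross3 g y'" by (rule diff_cross_surj)
  have "(x' + cross3 g x') \<bullet> (y' + cross3 g y') = (x' - cross3 g x') \<bullet> (y' - cross3 g y')"
    by (simp add: cross3_simps)
  then show ?thesis
    by (simp add: x y cayley_transform)
qed

lemma cayley_SO3: "cayley g \<in> SO3"
proof -
  have "cayley g ** (mat 1 - cross_matrix g) = mat 1 + cross_matrix g"
    by (rule matrix_eqI)
      (simp add: matrix_vector_mult_diff_rdistrib matrix_vector_mult_add_rdistrib
        cross_matrix_apply cayley_transform flip: matrix_vector_mul_assoc)
  then have "det (cayley g) * det (mat 1 - cross_matrix g) = det (mat 1 + cross_matrix g)"
    by (metis det_mul)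
  moreover have "det (mat 1 - cross_matrix g) = 1 + g \<bullet> g" "det (mat 1 + cross_matrix g) = 1 + g \<bullet> g"
    by (simp_all add: det_3 cross_matrix_def matrix_def mat_def axis_def cross3_def inner_vec_def
        sum_3 algebra_simps)
  ultimately have "det (cayley g) = 1"
    using one_plus_inner_pos[of g] by simp
  then show ?thesis
    by (simp add: SO3_def orthogonal_matrix_iff_inner cayley_inner)
qed

lemma cayley_0 [simp]: "cayley 0 = mat 1"
  by (rule matrix_eqI) (simp add: cayley_apply)

lemma cayley_entries:
  "cayley g $ i $ j = (1 / (1 + g \<bullet> g)) *
     ((1 - g \<bullet> g) * (if i = j then 1 else 0) + 2 * g$i * g$j + 2 * cross_matrix g $ i $ j)"
  unfolding cayley_def matrix_def mat_def by (simp add: inner_axis)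

lemma cross_matrix_entries:
  "cross_matrix g $ i $ i = 0"
  "cross_matrix g $ 1 $ 2 = - g$3" "cross_matrix g $ 2 $ 1 = g$3"
  "cross_matrix g $ 1 $ 3 = g$2" "cross_matrix g $ 3 $ 1 = - g$2"
  "cross_matrix g $ 2 $ 3 = - g$1" "cross_matrix g $ 3 $ 2 = g$1"
  using exhaust_3[of i] by (auto simp: cross_matrix_def matrix_def cross3_def axis_def)

lemma trace_cayley: "1 + trace (cayley g) = 4 / (1 + g \<bullet> g)"
proof -
  define N where "N = 1 + g \<bullet> g"
  have N: "N \<noteq> 0" "1 - g \<bullet> g = 2 - N"
    using one_plus_inner_pos[of g] by (simp_all add: N_def)
  have "N = 1 + (g$1 * g$1 + g$2 * g$2 + g$3 * g$3)"
    by (simp add: N_def inner_vec_def sum_3)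
  then show ?thesis
    unfolding trace_def sum_3 cayley_entries cross_matrix_entries N_def[symmetric] N(2)
    using N(1) by (simp add: divide_simps)
qed

lemma gibbs_vector_cayley: "gibbs_vector (cayley g) = g"
proof -
  have N: "1 + g \<bullet> g \<noteq> 0"
    using one_plus_inner_pos[of g] by simp
  then have "vector [cayley g$3$2 - cayley g$2$3, cayley g$1$3 - cayley g$3$1,
      cayley g$2$1 - cayley g$1$2] = (4 / (1 + g \<bullet> g)) *\<^sub>R g"
    unfolding cayley_entries cross_matrix_entries
    by (simp add: vec_eq_iff forall_3 divide_simps)
  moreover have "1 / (4 / N) * (4 / N) = 1" if "N \<noteq> 0" for N :: real
    using that by simp
  ultimately show ?thesis
    using N unfolding gibbs_vector_def trace_cayley by (metis scaleR_scaleR scaleR_one)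
qed

lemma skew_eq_cross:
  fixes A :: "real^3^3"
  assumes "\<And>y. y \<bullet> (A *v y) = 0"
  obtains g where "\<And>y. A *v y = cross3 g y"
proof
  let ?g = "vector [A$3$2, A$1$3, A$2$1] :: real^3"
  have polar: "y \<bullet> (A *v z) + z \<bullet> (A *v y) = 0" for y z
    using assms[of "y + z"] assms[of y] assms[of z]
    by (simp add: matrix_vector_right_distrib inner_add_left inner_add_right)
  have entry: "axis i 1 \<bullet> (A *v axis j 1) = A$i$j" for i j
    by (simp add: matrix_vector_mult_basis column_def inner_axis' )
  have skew: "A$i$j = - A$j$i" for i j
    using polar[of "axis i 1" "axis j 1"] by (simp add: entry)
  have diag: "A$i$i = 0" for i
    using skew[of i i] by simp
  show "A *v y = cross3 ?g y" for y
    using skew[of 1 2] skew[of 1 3] skew[of 2 3] diag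
    by (simp add: vec_eq_iff forall_3 matrix_vector_mult_def sum_3 cross3_def)
qed

text \<open>
  For a rotation \<open>Q\<close> with \<open>1 + Q\<close> invertible put \<open>A = (Q - 1) (1 + Q)\<^sup>-\<^sup>1\<close>.  Since \<open>Q z - z\<close> is orthogonal to
  \<open>Q z + z\<close>, the matrix \<open>A\<close> is skew, hence a cross product with a vector \<open>g\<close>, and solving for \<open>Q\<close> gives
  \<open>cayley g\<close>.
\<close>
lemma cayley_rotations_eq_range: "cayley_rotations = range cayley"
proof (intro equalityI subsetI)
  fix Q assume "Q \<in> cayley_rotations"
  then have Q: "Q \<in> SO3" "det (mat 1 + Q) \<noteq> 0"
    by (auto simp: cayley_rotations_def)
  then obtain P where P: "(mat 1 + Q) ** P = mat 1"
    using invertible_det_nz[of "mat 1 + Q"] unfolding invertible_def by blast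
  \<comment> \<open>The matrix \<open>A\<close> is known through its values at the vectors \<open>z + Q z\<close>, which are all vectors.\<close>
  define A where "A = (Q - mat 1) ** P"
  have rep: "\<exists>z. y = z + Q *v z \<and> A *v y = Q *v z - z" for y
  proof (intro exI conjI)
    show "y = P *v y + Q *v (P *v y)"
      using arg_cong[OF P, of "\<lambda>M. M *v y"]
      by (simp add: matrix_vector_mult_add_rdistrib flip: matrix_vector_mul_assoc)
    show "A *v y = Q *v (P *v y) - P *v y"
      by (simp add: A_def matrix_vector_mult_diff_rdistrib flip: matrix_vector_mul_assoc)
  qed
  have "y \<bullet> (A *v y) = 0" for y
  proof -
    obtain z where "y = z + Q *v z" "A *v y = Q *v z - z"
      using rep by blast
    then have "y \<bullet> (A *v y) = (z + Q *v z) \<bullet> (Q *v z - z)"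
      by simp
    then show ?thesis
      using SO3_inner[OF Q(1), of z z] by (simp add: algebra_simps inner_commute)
  qed
  then obtain g where g: "\<And>y. A *v y = cross3 g y"
    using skew_eq_cross by blast
  have "Q *v (x - cross3 g x) = x + cross3 g x" for x
  proof -
    obtain z where z: "x = z + Q *v z" "A *v x = Q *v z - z"
      using rep by blast
    have "x - cross3 g x = 2 *\<^sub>R z" "x + cross3 g x = 2 *\<^sub>R (Q *v z)"
      using z by (simp_all add: scaleR_2 flip: g)
    then show ?thesis
      by (simp add: matrix_vector_mult_scaleR)
  qed
  then show "Q \<in> range cayley"
    using cayley_unique by blast
next
  fix Q assume "Q \<in> range cayley"
  then obtain g where g: "Q = cayley g" by blast
  have "(mat 1 + Q) ** (mat 1 - cross_matrix g) = mat 1 + mat 1"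
    by (rule matrix_eqI, simp only: g matrix_vector_mult_diff_rdistrib
        matrix_vector_mult_add_rdistrib matrix_vector_mul_lid cross_matrix_apply cayley_transform
        flip: matrix_vector_mul_assoc) simp
  then have "det (mat 1 + Q) * det (mat 1 - cross_matrix g) = det (mat 1 + mat 1 :: real^3^3)"
    by (metis det_mul)
  also have "\<dots> \<noteq> 0"
    by (simp add: det_3 mat_def)
  finally show "Q \<in> cayley_rotations"
    by (auto simp: cayley_rotations_def g cayley_SO3)
qed

lemma cayley_homeomorphism: "homeomorphism UNIV cayley_rotations cayley gibbs_vector"
proof (rule homeomorphismI)
  have "1 + g \<bullet> g \<noteq> 0" for g :: "real^3"
    using one_plus_inner_pos[of g] by simp
  then show "continuous_on UNIV cayley"
    unfolding cayley_def cross_matrix_def matrix_def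
    by (intro continuous_intros continuous_on_component continuous_on_cross) auto
  have vector: "vector [a, b, c] = a *\<^sub>R axis 1 1 + b *\<^sub>R axis 2 1 + c *\<^sub>R (axis 3 1 :: real^3)"
    for a b c :: real
    by (simp add: vec_eq_iff forall_3 axis_def)
  have "1 + trace Q \<noteq> 0" if Q: "Q \<in> cayley_rotations" for Q
  proof -
    obtain g where "Q = cayley g"
      using Q by (auto simp: cayley_rotations_eq_range)
    then show ?thesis
      using one_plus_inner_pos[of g] by (simp add: trace_cayley)
  qed
  then show "continuous_on cayley_rotations gibbs_vector"
    unfolding gibbs_vector_def trace_def vector
    by (intro continuous_intros continuous_on_component) auto
qed (auto simp: cayley_rotations_eq_range gibbs_vector_cayley)

lemma openin_cayley_rotations: "openin (top_of_set SO3) cayley_rotations"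
proof -
  have "open {Q :: real^3^3. det (mat 1 + Q) \<noteq> 0}"
    by (intro open_Collect_neq continuous_intros)
  then show ?thesis
    unfolding cayley_rotations_def openin_open by blast
qed

lemma openin_cayley_image:
  assumes "open B"
  shows "openin (top_of_set SO3) (cayley ` B)"
  using homeomorphism_imp_open_map[OF cayley_homeomorphism, of B] assms openin_cayley_rotations
  by (simp add: openin_trans)

section \<open>The fibres over the first matrix\<close>

definition orthonormal_pair :: "real^3 \<Rightarrow> real^3 \<Rightarrow> bool" where
  "orthonormal_pair a b \<longleftrightarrow> a \<bullet> a = 1 \<and> b \<bullet> b = 1 \<and> a \<bullet> b = 0"

lemma orthonormal_pair_image:
  assumes "orthonormal_pair a b" "orthogonal_matrix A"
  shows "orthonormal_pair (A *v a) (A *v b)"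
  using assms by (simp add: orthonormal_pair_def orthogonal_matrix_inner)

text \<open>
  If \<open>p\<close> and \<open>q\<close> are orthonormal pairs, then the Gram matrix of \<open>p - q\<close> is determined by that of \<open>p + q\<close>
  (parallelogram law) and the products \<open>(p\<^sub>i + q\<^sub>i) \<bullet> (p\<^sub>j - q\<^sub>j)\<close> are skew in \<open>i, j\<close>.  So the differences of two
  decompositions of the same pair of vectors fall under \<open>pairs_with_equal_gram\<close>.
\<close>
lemma orthonormal_pairs_with_equal_sums:
  assumes on: "orthonormal_pair a1 a2" "orthonormal_pair b1 b2"
      "orthonormal_pair c1 c2" "orthonormal_pair d1 d2"
    and sums: "a1 + b1 = c1 + d1" "a2 + b2 = c2 + d2"
    and indep: "cross3 (c1 + d1) (c2 + d2) \<noteq> 0"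
  defines "r \<equiv> reflection (cross3 (c1 + d1) (c2 + d2))"
  shows "(a1, a2, b1, b2) \<in> {(c1, c2, d1, d2), (d1, d2, c1, c2),
    (r *v c1, r *v c2, r *v d1, r *v d2), (r *v d1, r *v d2, r *v c1, r *v c2)}"
proof -
  let ?m1 = "c1 + d1" and ?m2 = "c2 + d2"
  have m: "?m1 = a1 + b1" "?m2 = a2 + b2"
    using sums by simp_all
  \<comment> \<open>The reflection fixes the sums, so reflected differences belong to reflected pairs.\<close>
  have rm: "r *v ?m1 = ?m1" "r *v ?m2 = ?m2"
    unfolding r_def by (rule reflection_fixes, simp add: dot_cross_self)+
  note on' = on[unfolded orthonormal_pair_def]
  have skew: "(p1 + q1) \<bullet> (p1 - q1) = 0" "(p2 + q2) \<bullet> (p2 - q2) = 0"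
      "(p1 + q1) \<bullet> (p2 - q2) + (p2 + q2) \<bullet> (p1 - q1) = 0"
    if "orthonormal_pair p1 p2" "orthonormal_pair q1 q2" for p1 p2 q1 q2
    using that unfolding orthonormal_pair_def by (simp_all add: algebra_simps inner_commute)
  have parallelogram: "(x - y) \<bullet> (x' - y') = 2 * (x \<bullet> x') + 2 * (y \<bullet> y') - (x + y) \<bullet> (x' + y')"
    for x y x' y' :: "real^3"
    by (simp add: algebra_simps)
  have "(a1 - b1) \<bullet> (a1 - b1) = (c1 - d1) \<bullet> (c1 - d1)"
      "(a1 - b1) \<bullet> (a2 - b2) = (c1 - d1) \<bullet> (c2 - d2)"
      "(a2 - b2) \<bullet> (a2 - b2) = (c2 - d2) \<bullet> (c2 - d2)"
    unfolding parallelogram sums using on' by simp_all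
  then have "(a1 - b1 = c1 - d1 \<and> a2 - b2 = c2 - d2) \<or>
      (a1 - b1 = - (c1 - d1) \<and> a2 - b2 = - (c2 - d2)) \<or>
      (a1 - b1 = r *v (c1 - d1) \<and> a2 - b2 = r *v (c2 - d2)) \<or>
      (a1 - b1 = - (r *v (c1 - d1)) \<and> a2 - b2 = - (r *v (c2 - d2)))"
    unfolding r_def
    using skew[OF on(3,4)] skew[OF on(1,2), folded m] indep
    by (intro pairs_with_equal_gram)
  moreover have half: "x = x' \<and> y = y'" if "x + y = x' + y'" "x - y = x' - y'"
    for x y x' y' :: "real^3"
  proof -
    have "2 *\<^sub>R u = (u + v) + (u - v)" for u v :: "real^3"
      by (simp add: scaleR_2)
    then have "2 *\<^sub>R x = 2 *\<^sub>R x'"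
      using that by metis
    then show ?thesis using that by simp
  qed
  ultimately show ?thesis
  proof (elim disjE conjE)
    assume "a1 - b1 = c1 - d1" "a2 - b2 = c2 - d2"
    then show ?thesis
      using half[of a1 b1 c1 d1] half[of a2 b2 c2 d2] sums by simp
  next
    assume "a1 - b1 = - (c1 - d1)" "a2 - b2 = - (c2 - d2)"
    then show ?thesis
      using half[of a1 b1 d1 c1] half[of a2 b2 d2 c2] sums by (simp add: add.commute)
  next
    assume "a1 - b1 = r *v (c1 - d1)" "a2 - b2 = r *v (c2 - d2)"
    then show ?thesis
      using half[of a1 b1 "r *v c1" "r *v d1"] half[of a2 b2 "r *v c2" "r *v d2"] sums rm
      by (simp add: matrix_vector_right_distrib matrix_vector_mult_diff_distrib)
  next
    assume "a1 - b1 = - (r *v (c1 - d1))" "a2 - b2 = - (r *v (c2 - d2))"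
    then show ?thesis
      using half[of a1 b1 "r *v d1" "r *v c1"] half[of a2 b2 "r *v d2" "r *v c2"] sums rm
      by (simp add: matrix_vector_right_distrib matrix_vector_mult_diff_distrib add.commute)
  qed
qed

locale orthonormal_plane =
  fixes e1 e2 :: "real^3"
  assumes orthonormal: "orthonormal_pair e1 e2"
begin

abbreviation "e3 \<equiv> cross3 e1 e2"

abbreviation "rho \<equiv> plane_reflection e1 e2"

lemma inner_frame [simp]:
  "e1 \<bullet> e1 = 1" "e2 \<bullet> e2 = 1" "e1 \<bullet> e2 = 0" "e2 \<bullet> e1 = 0"
  "e3 \<bullet> e1 = 0" "e3 \<bullet> e2 = 0" "e1 \<bullet> e3 = 0" "e2 \<bullet> e3 = 0"
  using orthonormal by (simp_all add: orthonormal_pair_def inner_commute dot_cross_self)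

lemma inner_e3 [simp]: "e3 \<bullet> e3 = 1"
proof -
  have "cross3 u v \<bullet> cross3 u v = (u \<bullet> u) * (v \<bullet> v) - (u \<bullet> v) * (u \<bullet> v)" for u v
    by (simp add: cross3_simps)
  then show ?thesis by simp
qed

lemma e3_nonzero [simp]: "e3 \<noteq> 0"
  using inner_e3 by force

lemma frame_expansion: "x = (x \<bullet> e1) *\<^sub>R e1 + (x \<bullet> e2) *\<^sub>R e2 + (x \<bullet> e3) *\<^sub>R e3"
  by (rule eq_if_same_inner_adapted_frame[of e1 e2]) (simp_all add: inner_add_left)

lemma rho_fixes: "rho *v e1 = e1" "rho *v e2 = e2"
  by (simp_all add: plane_reflection_eq reflection_fixes)

lemma rho_rho: "rho ** rho = mat 1"
  by (simp add: plane_reflection_eq reflection_involution)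

lemma rho_improper: "- rho \<in> SO3"
  by (simp add: plane_reflection_eq reflection_improper)

lemma improper_eqI:
  assumes "- P \<in> SO3" "- P' \<in> SO3" "P *v e1 = P' *v e1" "P *v e2 = P' *v e2"
  shows "P = P'"
proof (rule matrix_eqI)
  have "cross3 (P *v e1) (P *v e2) = - (P *v e3)" "cross3 (P' *v e1) (P' *v e2) = - (P' *v e3)"
    using assms(1,2) by (simp_all add: uminus_SO3_iff cross_orthogonal_matrix)
  then have e3: "P *v e3 = P' *v e3"
    using assms by simp
  fix x
  show "P *v x = P' *v x"
    by (subst (1 2) frame_expansion[of x])
      (simp only: matrix_vector_right_distrib matrix_vector_mult_scaleR assms e3)
qed

lemma improper_extension_eq:
  assumes "- P \<in> SO3" "P *v e1 = a1" "P *v e2 = a2"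
  shows "improper_extension e1 e2 a1 a2 = P"
  unfolding improper_extension_def
  using assms by (intro the_equality) (auto intro: improper_eqI)

definition mid_normal :: "real^3^3 \<Rightarrow> real^3" where
  "mid_normal Q = cross3 (e1 + Q *v e1) (e2 + Q *v e2)"

definition mid_reflection :: "real^3^3 \<Rightarrow> real^3^3" where
  "mid_reflection Q = reflection (mid_normal Q)"

text \<open>
  The vectors \<open>e\<^sub>i + Q e\<^sub>i\<close> are the images of \<open>e\<^sub>i\<close> under \<open>1 + Q\<close>, so their normal is the image of \<open>e\<^sub>3\<close> under
  the cofactor matrix of \<open>1 + Q\<close>.
\<close>
lemma mid_normal_cofactor:
  "transpose (mat 1 + Q) *v mid_normal Q = det (mat 1 + Q) *\<^sub>R e3"
  using cross_matrix_mult[of "mat 1 + Q" e1 e2]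
  by (simp add: mid_normal_def matrix_vector_mult_add_rdistrib)

lemma mid_normal_nonzero:
  assumes "Q \<in> cayley_rotations"
  shows "mid_normal Q \<noteq> 0"
  using mid_normal_cofactor[of Q] assms by (auto simp: cayley_rotations_def)

text \<open>
  Since \<open>1 + Q\<close> is twice the inverse of \<open>1 - A\<close>, its cofactor matrix is proportional to
  \<open>(1 - A)\<^sup>T = 1 + A\<close>.
\<close>
lemma mid_reflection_cayley: "mid_reflection (cayley g) = reflection (e3 + cross3 g e3)"
proof -
  let ?P = "mat 1 + cayley g"
  have "(2 *\<^sub>R mid_normal (cayley g)) \<bullet> x = (det ?P *\<^sub>R (e3 + cross3 g e3)) \<bullet> x" for x
  proof -
    have "?P *v (x - cross3 g x) = 2 *\<^sub>R x"
      by (simp add: matrix_vector_mult_add_rdistrib cayley_transform scaleR_2)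
    then have "(2 *\<^sub>R mid_normal (cayley g)) \<bullet> x = mid_normal (cayley g) \<bullet> (?P *v (x - cross3 g x))"
      by simp
    also have "\<dots> = (transpose ?P *v mid_normal (cayley g)) \<bullet> (x - cross3 g x)"
      by (simp add: dot_lmul_matrix)
    also have "\<dots> = (det ?P *\<^sub>R (e3 + cross3 g e3)) \<bullet> x"
    proof -
      have "u \<bullet> cross3 g x = - (cross3 g u \<bullet> x)" for u
        by (simp add: cross3_simps)
      then show ?thesis
        unfolding mid_normal_cofactor
          by (simp add: inner_diff_right inner_add_left cross_mult_right distrib_left)
    qed
    finally show ?thesis .
  qed
  then have "2 *\<^sub>R mid_normal (cayley g) = det ?P *\<^sub>R (e3 + cross3 g e3)"
    by (metis vector_eq_rdot)
  moreover have "det ?P \<noteq> 0"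
    using cayley_rotations_eq_range by (auto simp: cayley_rotations_def)
  ultimately show ?thesis
    unfolding mid_reflection_def by (metis reflection_scale zero_neq_numeral)
qed

lemma mid_reflection_1 [simp]: "mid_reflection (mat 1) = rho"
  using mid_reflection_cayley[of 0] by (simp add: plane_reflection_eq)

context
  fixes Q assumes Q: "Q \<in> cayley_rotations"
begin

lemma mid_reflection_improper: "- mid_reflection Q \<in> SO3"
  by (simp add: mid_reflection_def mid_normal_nonzero Q reflection_improper)

lemma mid_reflection_involution: "mid_reflection Q ** mid_reflection Q = mat 1"
  by (simp add: mid_reflection_def mid_normal_nonzero Q reflection_involution)

end

lemma mid_reflection_fixes:
  "mid_reflection Q *v (e1 + Q *v e1) = e1 + Q *v e1"
  "mid_reflection Q *v (e2 + Q *v e2) = e2 + Q *v e2"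
  by (simp_all only: mid_reflection_def mid_normal_def reflection_fixes dot_cross_self)

lemma continuous_on_mid_reflection: "continuous_on cayley_rotations mid_reflection"
  unfolding mid_reflection_def using mid_normal_nonzero
  by (intro continuous_intros) (auto simp: mid_normal_def intro!: continuous_intros continuous_on_cross)

text \<open>
  The first index tells whether the two improper matrices are exchanged, the second whether they are reflected.
  On \<open>e\<^sub>1, e\<^sub>2\<close> the matrix \<open>\<rho>\<close> is the identity, so the sheet \<open>(False, False)\<close> is the decomposition of
  \<open>e\<^sub>i + Q e\<^sub>i\<close> into \<open>e\<^sub>i\<close> and \<open>Q e\<^sub>i\<close>.
\<close>
fun sheet :: "bool \<times> bool \<Rightarrow> real^3^3 \<Rightarrow> matrix_triple" where
  "sheet (False, False) Q = (Q, rho, Q ** rho)"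
| "sheet (True, False) Q = (Q, Q ** rho, rho)"
| "sheet (False, True) Q = (Q, mid_reflection Q, mid_reflection Q ** Q)"
| "sheet (True, True) Q = (Q, mid_reflection Q ** Q, mid_reflection Q)"

lemma all_sheets: "(\<forall>i. P i) \<longleftrightarrow> P (False, False) \<and> P (True, False) \<and> P (False, True) \<and> P (True, True)"
  by (metis surj_pair)

lemma fst_sheet [simp]: "fst (sheet i Q) = Q"
  by (cases "(i, Q)" rule: sheet.cases) simp_all

lemma sheet_at_1 [simp]: "sheet i (mat 1) = Q_aristotype e1 e2"
  by (cases "(i, mat 1 :: real^3^3)" rule: sheet.cases) (simp_all add: Q_aristotype_def)

lemma continuous_on_sheet: "continuous_on cayley_rotations (sheet i)"
proof -
  have "\<forall>i. continuous_on cayley_rotations (sheet i)"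
    unfolding all_sheets sheet.simps[abs_def]
    by (intro conjI continuous_intros continuous_on_mid_reflection)
  then show ?thesis ..
qed

lemma sheet_in_Q_space:
  assumes Q: "Q \<in> cayley_rotations"
  shows "sheet i Q \<in> Q_space e1 e2"
proof -
  have "Q \<in> SO3"
    using Q by (simp add: cayley_rotations_def)
  moreover note rho_improper mid_reflection_improper[OF Q] mid_reflection_fixes
  ultimately have "\<forall>i. sheet i Q \<in> Q_space e1 e2"
    unfolding all_sheets Q_space_def
    by (auto simp: SO3_mult_improper improper_mult_SO3 rho_fixes matrix_vector_right_distrib add.commute
        simp flip: matrix_vector_mul_assoc)
  then show ?thesis ..
qed

lemma Q_space_fibre:
  assumes x: "x \<in> Q_space e1 e2" "fst x \<in> cayley_rotations"
  obtains i where "x = sheet i (fst x)"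
proof -
  obtain Q Q1 Q2 where eq: "x = (Q, Q1, Q2)"
    by (cases x)
  let ?r = "mid_reflection Q"
  have Q: "Q \<in> cayley_rotations" "Q \<in> SO3" and Q12: "- Q1 \<in> SO3" "- Q2 \<in> SO3"
    and sums: "Q1 *v e1 + Q2 *v e1 = e1 + Q *v e1" "Q1 *v e2 + Q2 *v e2 = e2 + Q *v e2"
    using x by (auto simp: eq Q_space_def)
  have "(Q1 *v e1, Q1 *v e2, Q2 *v e1, Q2 *v e2) \<in>
      {(e1, e2, Q *v e1, Q *v e2), (Q *v e1, Q *v e2, e1, e2),
       (?r *v e1, ?r *v e2, ?r *v (Q *v e1), ?r *v (Q *v e2)),
       (?r *v (Q *v e1), ?r *v (Q *v e2), ?r *v e1, ?r *v e2)}"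
    unfolding mid_reflection_def mid_normal_def
    using sums mid_normal_nonzero[OF Q(1)] Q(2) Q12
    by (intro orthonormal_pairs_with_equal_sums orthonormal_pair_image orthonormal)
      (simp_all add: uminus_SO3_iff SO3_def mid_normal_def)
  then consider "Q1 *v e1 = rho *v e1" "Q1 *v e2 = rho *v e2"
      "Q2 *v e1 = (Q ** rho) *v e1" "Q2 *v e2 = (Q ** rho) *v e2"
    | "Q1 *v e1 = (Q ** rho) *v e1" "Q1 *v e2 = (Q ** rho) *v e2"
      "Q2 *v e1 = rho *v e1" "Q2 *v e2 = rho *v e2"
    | "Q1 *v e1 = ?r *v e1" "Q1 *v e2 = ?r *v e2"
      "Q2 *v e1 = (?r ** Q) *v e1" "Q2 *v e2 = (?r ** Q) *v e2"
    | "Q1 *v e1 = (?r ** Q) *v e1" "Q1 *v e2 = (?r ** Q) *v e2"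
      "Q2 *v e1 = ?r *v e1" "Q2 *v e2 = ?r *v e2"
    unfolding insert_iff empty_iff prod.inject matrix_vector_mul_assoc[symmetric] rho_fixes
    by argo
  then have "\<exists>i. x = sheet i Q"
  proof cases
    case 1
    then have "x = sheet (False, False) Q"
      using Q12 Q(2) by (simp add: eq improper_eqI rho_improper SO3_mult_improper)
    then show ?thesis ..
  next
    case 2
    then have "x = sheet (True, False) Q"
      using Q12 Q(2) by (simp add: eq improper_eqI rho_improper SO3_mult_improper)
    then show ?thesis ..
  next
    case 3
    then have "x = sheet (False, True) Q"
      using Q12 Q by (simp add: eq improper_eqI mid_reflection_improper improper_mult_SO3)
    then show ?thesis ..
  next
    case 4
    then have "x = sheet (True, True) Q"
      using Q12 Q by (simp add: eq improper_eqI mid_reflection_improper improper_mult_SO3)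
    then show ?thesis ..
  qed
  then show ?thesis
    using that by (auto simp: eq)
qed

text \<open>
  Two sheets meet where the normal \<open>e\<^sub>3 + g \<times> e\<^sub>3\<close> is parallel to \<open>e\<^sub>3\<close>, that is, \<open>g\<close> is parallel to \<open>e\<^sub>3\<close>,
  and where \<open>g\<close> is orthogonal to \<open>e\<^sub>3\<close>.  The first locus is a line; the hyperplane \<open>g \<bullet> e1 = 0\<close> containing it is
  removed instead, so that density is a fact about hyperplanes.
\<close>
definition generic :: "(real^3) set" where
  "generic = {g. g \<bullet> e1 \<noteq> 0 \<and> g \<bullet> e3 \<noteq> 0}"

lemma open_generic: "open generic"
  unfolding generic_def by (intro open_Collect_conj open_Collect_neq continuous_intros)

lemma closure_generic: "closure generic = UNIV"
proof -
  have e: "e1 \<noteq> 0" using inner_frame(1) by force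
  have "- generic = {x. e1 \<bullet> x = 0} \<union> {x. e3 \<bullet> x = 0}"
    by (auto simp: generic_def inner_commute)
  then have "interior (- generic) = {}"
    using e by (simp add: interior_closed_Un_empty_interior closed_hyperplane interior_hyperplane)
  then show ?thesis
    by (simp add: interior_complement) (metis Compl_empty_eq double_complement)
qed

text \<open>
  Two sheets agree at \<open>Q\<close> only if \<open>Q = 1\<close>, \<open>r = \<rho>\<close> or \<open>r Q = \<rho>\<close>.  The first is a case of the second.
  Evaluating the second at \<open>e\<^sub>3\<close>, and the third at the axis \<open>g\<close>, which \<open>Q\<close> fixes, would make the normals
  of the two reflections parallel.
\<close>
lemma sheets_distinct:
  assumes g: "g \<in> generic"
  shows "inj (\<lambda>i. sheet i (cayley g))"
proof -
  let ?Q = "cayley g" and ?N = "e3 + cross3 g e3"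
  let ?r = "reflection ?N"
  have Q: "?Q \<in> cayley_rotations"
    by (simp add: cayley_rotations_eq_range)
  have g: "g \<bullet> e1 \<noteq> 0" "g \<bullet> e3 \<noteq> 0"
    using g by (auto simp: generic_def)
  have perp: "cross3 g e3 \<bullet> e3 = 0" "e3 \<bullet> cross3 g e3 = 0"
    by (simp_all add: dot_cross_self)
  have "cross3 g e3 \<bullet> e2 = - (g \<bullet> e1)"
    by (simp add: Lagrange inner_diff_left)
  then have cross: "cross3 g e3 \<noteq> 0"
    using g by auto
  define N where "N = ?N"
  have e3_N: "e3 \<bullet> N = 1"
    by (simp add: N_def perp inner_add_right)
  have g_N: "g \<bullet> N = g \<bullet> e3"
    by (simp add: N_def inner_add_right dot_cross_self)
  have not_parallel: "e3 \<noteq> c *\<^sub>R N" for c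
  proof
    assume e3: "e3 = c *\<^sub>R N"
    have "c = 1"
      using arg_cong[OF e3, of "\<lambda>v. e3 \<bullet> v"] by (simp add: e3_N)
    with e3 have "e3 = e3 + cross3 g e3"
      by (metis N_def scaleR_one)
    with cross show False
      by (metis add_cancel_right_right)
  qed
  have r_rho: "?r \<noteq> rho"
  proof
    assume "?r = rho"
    then have "reflection N *v e3 = rho *v e3"
      by (simp only: N_def)
    then have "(2 / (N \<bullet> N)) *\<^sub>R N = 2 *\<^sub>R e3"
      by (simp add: plane_reflection_eq reflection_apply e3_N)
    then have "(1/2) *\<^sub>R ((2 / (N \<bullet> N)) *\<^sub>R N) = (1/2) *\<^sub>R (2 *\<^sub>R e3)"
      by (rule arg_cong)
    then have "(1/2 * (2 / (N \<bullet> N))) *\<^sub>R N = e3"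
      by simp
    then show False
      using not_parallel by metis
  qed
  have rQ_rho: "?r ** ?Q \<noteq> rho"
  proof
    assume "?r ** ?Q = rho"
    moreover have "?Q *v g = g"
      using cayley_transform[of g g] by simp
    ultimately have "reflection N *v g = rho *v g"
      unfolding N_def by (metis matrix_vector_mul_assoc)
    then have "(2 * (g \<bullet> e3) / (N \<bullet> N)) *\<^sub>R N = (2 * (g \<bullet> e3)) *\<^sub>R e3"
      by (simp add: plane_reflection_eq reflection_apply g_N)
    then have "(1 / (2 * (g \<bullet> e3))) *\<^sub>R ((2 * (g \<bullet> e3) / (N \<bullet> N)) *\<^sub>R N)
        = (1 / (2 * (g \<bullet> e3))) *\<^sub>R ((2 * (g \<bullet> e3)) *\<^sub>R e3)"
      by (rule arg_cong)
    then have "(1 / (2 * (g \<bullet> e3)) * (2 * (g \<bullet> e3) / (N \<bullet> N))) *\<^sub>R N = e3"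
      using g by simp
    then show False
      using not_parallel by metis
  qed
  have Q_1: "?Q \<noteq> mat 1"
    using r_rho mid_reflection_1 by (metis mid_reflection_cayley)
  have "?Q ** rho \<noteq> rho"
    using Q_1 rho_rho by (metis matrix_mul_assoc matrix_mul_rid)
  moreover have "?r ** ?Q \<noteq> ?r"
    using Q_1 mid_reflection_involution[OF Q]
    by (metis matrix_mul_assoc matrix_mul_rid matrix_mul_lid mid_reflection_cayley)
  ultimately have "\<forall>i j. sheet i ?Q = sheet j ?Q \<longrightarrow> i = j"
    unfolding all_sheets using r_rho rQ_rho by (auto simp: mid_reflection_cayley)
  then show ?thesis
    by (simp add: inj_def)
qed

end

section \<open>The ramified covering and the action\<close>

context orthonormal_plane
begin

declare split_paired_Ex [simp del] split_paired_All [simp del]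

definition space_over :: "(real^3^3) set \<Rightarrow> matrix_triple set" where
  "space_over U = {x \<in> Q_space e1 e2. fst x \<in> U}"

lemma space_over_eq_sheets:
  assumes "U \<subseteq> cayley_rotations"
  shows "space_over U = (\<Union>i. sheet i ` U)"
proof (intro equalityI subsetI)
  fix x assume x: "x \<in> space_over U"
  then obtain i where "x = sheet i (fst x)"
    using assms Q_space_fibre[of x] by (auto simp: space_over_def)
  moreover have "fst x \<in> U"
    using x by (simp add: space_over_def)
  ultimately show "x \<in> (\<Union>i. sheet i ` U)"
    by blast
next
  fix x assume "x \<in> (\<Union>i. sheet i ` U)"
  then obtain i Q where "x = sheet i Q" "Q \<in> U"
    by blast
  then show "x \<in> space_over U"
    using assms sheet_in_Q_space by (simp add: space_over_def subset_iff)
qed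

lemma sheet_cases:
  assumes "x \<in> space_over U" "U \<subseteq> cayley_rotations"
  obtains i Q where "x = sheet i Q" "Q \<in> U"
  using assms space_over_eq_sheets by blast

lemma cayley_image_subset: "cayley ` B \<subseteq> cayley_rotations"
  by (auto simp: cayley_rotations_eq_range)

lemma continuous_on_sheet_cayley: "continuous_on UNIV (\<lambda>g. sheet i (cayley g))"
  using continuous_on_compose2[OF continuous_on_sheet homeomorphism_cont1[OF cayley_homeomorphism]]
  by (simp add: cayley_rotations_eq_range)

lemma closedin_sheet:
  assumes "continuous_on S f" "fst ` f ` S \<subseteq> cayley_rotations"
  shows "closedin (top_of_set S) {x \<in> S. f x = sheet i (fst (f x))}"
proof -
  have "continuous_on S (\<lambda>x. f x - sheet i (fst (f x)))"
    using assms by (intro continuous_intros continuous_on_compose2[OF continuous_on_sheet]) auto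
  then show ?thesis
    using continuous_closedin_preimage_constant[of S "\<lambda>x. f x - sheet i (fst (f x))" 0] by simp
qed

lemma finite_fibre:
  assumes "U \<subseteq> cayley_rotations" "Q \<in> U"
  shows "{x \<in> space_over U. fst x = Q} = range (\<lambda>i. sheet i Q)"
proof (intro equalityI subsetI)
  fix x assume "x \<in> {x \<in> space_over U. fst x = Q}"
  then have "x \<in> space_over U" "fst x = Q"
    by simp_all
  then obtain i where "x = sheet i Q"
    using assms(1) by (metis sheet_cases fst_sheet)
  then show "x \<in> range (\<lambda>i. sheet i Q)"
    by simp
next
  fix x assume "x \<in> range (\<lambda>i. sheet i Q)"
  then obtain i where x: "x = sheet i Q"
    by (rule rangeE)
  show "x \<in> {x \<in> space_over U. fst x = Q}"
    unfolding x space_over_eq_sheets[OF assms(1)] using assms(2) by simp (rule exI[of _ i], rule imageI)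
qed

lemma proper_map_over:
  assumes U: "U \<subseteq> cayley_rotations"
  shows "proper_map (top_of_set (space_over U)) (top_of_set U) fst"
  unfolding proper_map_def closed_map_def
proof (intro conjI allI impI ballI)
  fix C assume C: "closedin (top_of_set (space_over U)) C"
  then have "C \<subseteq> space_over U"
    using closedin_subset by fastforce
  have image: "fst ` C = (\<Union>i. U \<inter> sheet i -` C)"
  proof (intro equalityI subsetI)
    fix Q assume "Q \<in> fst ` C"
    then obtain x where x: "x \<in> C" "Q = fst x"
      by blast
    then obtain i Q' where "x = sheet i Q'" "Q' \<in> U"
      using \<open>C \<subseteq> space_over U\<close> U by (metis sheet_cases subsetD)
    with x show "Q \<in> (\<Union>i. U \<inter> sheet i -` C)"
      by auto
  next
    fix Q assume "Q \<in> (\<Union>i. U \<inter> sheet i -` C)"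
    then obtain i where "sheet i Q \<in> C"
      by blast
    then show "Q \<in> fst ` C"
      by (metis fst_sheet imageI)
  qed
  have "closedin (top_of_set U) (U \<inter> sheet i -` C)" for i
    using continuous_on_subset[OF continuous_on_sheet U] space_over_eq_sheets[OF U] C
    by (intro continuous_closedin_preimage_gen) auto
  then show "closedin (top_of_set U) (fst ` C)"
    unfolding image by (intro closedin_Union) auto
next
  fix Q assume "Q \<in> topspace (top_of_set U)"
  then have "finite {x \<in> space_over U. fst x = Q}"
    using U by (simp add: finite_fibre)
  then show "compactin (top_of_set (space_over U)) {x \<in> topspace (top_of_set (space_over U)). fst x = Q}"
    by (auto intro: finite_imp_compactin)
qed

text \<open>
  The graphs over \<open>V\<close> are closed in the space over \<open>V\<close>, finite in number and disjoint; hence they are open as well.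
\<close>
lemma trivial_covering:
  assumes V: "V \<subseteq> cayley_rotations" and distinct: "\<And>Q. Q \<in> V \<Longrightarrow> inj (\<lambda>i. sheet i Q)"
  shows "covering_space (space_over V) fst V"
proof -
  have space_over: "space_over V = (\<Union>i. sheet i ` V)"
    by (rule space_over_eq_sheets[OF V])
  have unique: "i = j" if "x \<in> sheet i ` V" "x \<in> sheet j ` V" for i j x
    using that distinct by (metis fst_sheet imageE injD)
  have closed: "closedin (top_of_set (space_over V)) (sheet i ` V)" for i
  proof -
    have eq: "sheet i ` V = {x \<in> space_over V. x = sheet i (fst x)}"
    proof (intro equalityI subsetI CollectI conjI)
      fix x assume "x \<in> {x \<in> space_over V. x = sheet i (fst x)}"
      then have "fst x \<in> V" and x: "x = sheet i (fst x)"
        unfolding space_over_def by blast+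
      then show "x \<in> sheet i ` V"
        by (metis imageI)
    next
      fix x assume x: "x \<in> sheet i ` V"
      then show "x \<in> space_over V"
        unfolding space_over by blast
      show "x = sheet i (fst x)"
        using x by (elim imageE) simp
    qed
    have "fst ` (\<lambda>x. x) ` space_over V \<subseteq> cayley_rotations"
      using V unfolding space_over_def by blast
    then show ?thesis
      unfolding eq by (rule closedin_sheet[OF continuous_on_id])
  qed
  have "openin (top_of_set (space_over V)) (sheet i ` V)" for i
  proof -
    have "sheet i ` V = space_over V - (\<Union>j\<in>-{i}. sheet j ` V)"
    proof (intro equalityI subsetI)
      fix x assume x: "x \<in> sheet i ` V"
      show "x \<in> space_over V - (\<Union>j\<in>-{i}. sheet j ` V)"
      proof (intro DiffI notI)
        show "x \<in> space_over V"
          unfolding space_over using x by (rule UN_I[OF UNIV_I])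
        assume "x \<in> (\<Union>j\<in>-{i}. sheet j ` V)"
        then obtain j where "j \<noteq> i" "x \<in> sheet j ` V"
          by (elim UN_E) simp
        then show False
          using unique[OF x] by metis
      qed
    next
      fix x assume "x \<in> space_over V - (\<Union>j\<in>-{i}. sheet j ` V)"
      then have "x \<in> (\<Union>j. sheet j ` V)" and not: "x \<notin> (\<Union>j\<in>-{i}. sheet j ` V)"
        unfolding space_over by simp_all
      then obtain j where j: "x \<in> sheet j ` V"
        by (elim UN_E)
      then have "j = i"
        using not UN_I[of j "- {i}"] by (metis ComplI singletonD)
      with j show "x \<in> sheet i ` V"
        by simp
    qed
    moreover have "closedin (top_of_set (space_over V)) (\<Union>j\<in>-{i}. sheet j ` V)"
      using closed by (intro closedin_Union) auto
    ultimately show ?thesis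
      by (metis openin_diff openin_subtopology_self)
  qed
  moreover have "\<exists>q. homeomorphism (sheet i ` V) V fst q" for i
    using continuous_on_subset[OF continuous_on_sheet V, of i]
    by (intro exI[of _ "sheet i"])
      (auto simp: homeomorphism_def image_image intro!: continuous_intros)
  moreover have "pairwise disjnt (range (\<lambda>i. sheet i ` V))"
  proof (rule pairwiseI)
    fix A B assume "A \<in> range (\<lambda>i. sheet i ` V)" "B \<in> range (\<lambda>i. sheet i ` V)" "A \<noteq> B"
    then obtain i j where "A = sheet i ` V" "B = sheet j ` V" "i \<noteq> j"
      by blast
    then show "disjnt A B"
      unfolding disjnt_iff using unique[of _ i j] by blast
  qed
  moreover have "space_over V \<inter> fst -` V = (\<Union>i. sheet i ` V)"
    unfolding space_over[symmetric] space_over_def by blast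
  ultimately have "\<exists>v. \<Union>v = space_over V \<inter> fst -` V \<and> (\<forall>u\<in>v. openin (top_of_set (space_over V)) u) \<and>
      pairwise disjnt v \<and> (\<forall>u\<in>v. \<exists>q. homeomorphism u V fst q)"
    by (intro exI[of _ "range (\<lambda>i. sheet i ` V)"] conjI) (simp_all only: ball_simps ball_UNIV simp_thms)
  moreover have "fst ` space_over V = V"
    unfolding space_over by (simp add: image_UN image_image)
  ultimately show ?thesis
    unfolding covering_space_def
    by (intro conjI ballI exI[of _ V] continuous_on_fst continuous_on_id openin_subtopology_self)
qed

lemma ramified_covering_over:
  assumes B: "open B"
  shows "ramified_covering (space_over (cayley ` B)) fst (cayley ` B) 4"
proof -
  define U V where "U = cayley ` B" and "V = cayley ` (B \<inter> generic)"
  have U: "U \<subseteq> cayley_rotations" and V: "V \<subseteq> cayley_rotations" "V \<subseteq> U"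
    by (auto simp: U_def V_def cayley_rotations_eq_range)
  have B_closure: "B \<subseteq> closure (B \<inter> generic)"
    using open_Int_closure_subset[OF B, of generic] by (simp add: closure_generic)
  have closure_image: "f ` B \<subseteq> closure (f ` (B \<inter> generic))"
    if "continuous_on UNIV f" for f :: "real^3 \<Rightarrow> 'b::topological_space"
    using B_closure image_closure_subset[OF continuous_on_subset[OF that subset_UNIV] closed_closure
        closure_subset, of "B \<inter> generic"] by blast
  have distinct: "inj (\<lambda>i. sheet i Q)" if "Q \<in> V" for Q
    using that sheets_distinct by (auto simp: V_def)
  have overV: "space_over U \<inter> fst -` V = space_over V"
    using V by (auto simp: space_over_def)
  have "openin (top_of_set SO3) V"
    unfolding V_def using B open_generic by (intro openin_cayley_image open_Int)
  moreover have "U \<subseteq> SO3"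
    unfolding U_def using cayley_SO3 by blast
  ultimately have openin: "openin (top_of_set U) V"
    using V(2) by (intro openin_subset_trans[of SO3 V U])
  have dense: "U \<subseteq> closure V"
    unfolding U_def V_def
    by (rule closure_image[OF homeomorphism_cont1[OF cayley_homeomorphism]])
  have over_dense: "space_over U \<subseteq> closure (space_over V)"
  proof
    fix x assume "x \<in> space_over U"
    then obtain i Q where "x = sheet i Q" "Q \<in> U"
      using U by (rule sheet_cases)
    then obtain g where x: "x = sheet i (cayley g)" "g \<in> B"
      unfolding U_def by blast
    have "sheet i (cayley g) \<in> closure ((\<lambda>g. sheet i (cayley g)) ` (B \<inter> generic))"
      using closure_image[OF continuous_on_sheet_cayley, of i] x(2) by blast
    moreover have "(\<lambda>g. sheet i (cayley g)) ` (B \<inter> generic) \<subseteq> space_over V"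
      unfolding space_over_eq_sheets[OF V(1)] by (auto simp: V_def)
    ultimately show "x \<in> closure (space_over V)"
      using closure_mono x(1) by blast
  qed
  have card: "card {x \<in> space_over U. fst x = Q} = 4" if "Q \<in> V" for Q
    using that V distinct[of Q] by (subst finite_fibre[OF U]) (auto simp: card_image)
  show ?thesis
    unfolding ramified_covering_def U_def[symmetric]
  proof (intro conjI exI[of _ V] ballI)
    show "continuous_on (space_over U) fst"
      by (intro continuous_on_fst continuous_on_id)
    show "fst ` space_over U = U"
      unfolding space_over_eq_sheets[OF U] by (simp add: image_UN image_image)
    show "proper_map (top_of_set (space_over U)) (top_of_set U) fst"
      by (rule proper_map_over[OF U])
    show "covering_space (space_over U \<inter> fst -` V) fst V"
      unfolding overV by (rule trivial_covering[OF V(1) distinct])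
    show "space_over U \<subseteq> closure (space_over U \<inter> fst -` V)"
      unfolding overV by (rule over_dense)
  qed (rule openin dense card, assumption?)+
qed

text \<open>
  All four sheets pass through the aristotype, and they depend continuously on the Gibbs vector.
\<close>
lemma small_neighbourhood:
  assumes "open N" "Q_aristotype e1 e2 \<in> N"
  obtains d where "d > 0" "space_over (cayley ` ball 0 d) \<subseteq> N"
proof -
  let ?P = "\<Inter>i. (\<lambda>g. sheet i (cayley g)) -` N"
  have "open ?P"
    using assms continuous_on_sheet_cayley by (intro open_INT) (auto intro: open_vimage)
  moreover have "0 \<in> ?P"
    using assms by simp
  ultimately obtain d where "d > 0" "ball 0 d \<subseteq> ?P"
    by (rule openE)
  then show ?thesis
    using that[of d] space_over_eq_sheets[OF cayley_image_subset] by auto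
qed

lemma relabel_sheet: "relabel (sheet (a, b) Q) = sheet (\<not> a, b) Q"
  by (cases a; cases b) (simp_all add: relabel_def)

text \<open>
  The matrix \<open>r P\<close> has the prescribed values but determinant \<open>1\<close>; composing it with \<open>\<rho>\<close>, which
  fixes \<open>e\<^sub>1\<close> and \<open>e\<^sub>2\<close>, corrects the determinant.
\<close>
lemma reflect_eq:
  assumes "Q \<in> cayley_rotations" "- Q1 \<in> SO3" "- Q2 \<in> SO3"
  shows "reflect e1 e2 (Q, Q1, Q2) = (Q, mid_reflection Q ** Q1 ** rho, mid_reflection Q ** Q2 ** rho)"
proof -
  let ?w1 = "e1 + Q *v e1" and ?w2 = "e2 + Q *v e2"
  have n: "cross3 ?w1 ?w2 \<noteq> 0"
    using mid_normal_nonzero[OF assms(1)] by (simp add: mid_normal_def)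
  then have "?w1 \<noteq> 0" "?w2 \<noteq> 0"
    by auto
  then have r: "plane_reflection (arc_midpoint e1 (Q *v e1)) (arc_midpoint e2 (Q *v e2)) = mid_reflection Q"
    using reflection_scale[of "inverse (norm ?w1) * inverse (norm ?w2)" "cross3 ?w1 ?w2"]
    by (simp add: plane_reflection_eq arc_midpoint_def sgn_div_norm mid_reflection_def
        mid_normal_def cross_mult_left cross_mult_right mult.commute)
  have "improper_extension e1 e2 (mid_reflection Q *v (P *v e1)) (mid_reflection Q *v (P *v e2))
      = mid_reflection Q ** P ** rho" if "- P \<in> SO3" for P
    using that assms rho_improper mid_reflection_improper
    by (intro improper_extension_eq SO3_mult_improper improper_mult_improper)
      (simp_all add: rho_fixes flip: matrix_vector_mul_assoc)
  then show ?thesis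
    using assms by (simp add: reflect_def r Let_def)
qed

lemma reflect_sheet:
  assumes Q: "Q \<in> cayley_rotations"
  shows "reflect e1 e2 (sheet (a, b) Q) = sheet (a, \<not> b) Q"
proof -
  have SO3: "Q \<in> SO3"
    using Q by (simp add: cayley_rotations_def)
  have 1: "X ** rho ** rho = X" for X
    by (simp add: rho_rho flip: matrix_mul_assoc)
  have 2: "mid_reflection Q ** (mid_reflection Q ** X) = X" for X
    by (simp add: mid_reflection_involution[OF Q] matrix_mul_assoc)
  show ?thesis
    using Q SO3 rho_improper mid_reflection_improper[OF Q] 2[of rho] 2[of "mat 1"]
    by (cases a; cases b)
      (simp_all add: reflect_eq SO3_mult_improper improper_mult_SO3 1 mid_reflection_involution
        matrix_mul_assoc)
qed

context
  fixes U assumes U: "U \<subseteq> cayley_rotations"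
begin

text \<open>
  The group acts on the indices of the sheets by translation, the truth value \<open>True\<close> standing for \<open>1\<close>.
\<close>
lemma natural_action_sheet:
  assumes "(a, b) \<in> carrier Z2xZ2" "Q \<in> U"
  shows "natural_action e1 e2 (space_over U) (a, b) (sheet (c, d) Q) = sheet (c \<noteq> (a = 1), d \<noteq> (b = 1)) Q"
proof -
  have "a \<in> {0, 1}" "b \<in> {0, 1}"
    using assms(1) by (auto simp: carrier_integer_mod_group)
  moreover have "sheet (c, d) Q \<in> space_over U" "Q \<in> cayley_rotations"
    using assms U space_over_eq_sheets[OF U] by auto
  ultimately show ?thesis
    by (auto simp: natural_action_def relabel_sheet reflect_sheet)
qed

lemma natural_action_in:
  assumes "z \<in> carrier Z2xZ2" "x \<in> space_over U"
  shows "natural_action e1 e2 (space_over U) z x \<in> space_over U"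
    and "fst (natural_action e1 e2 (space_over U) z x) = fst x"
proof -
  obtain a b where z: "z = (a, b)" by (cases z)
  obtain c d Q where x: "x = sheet (c, d) Q" "Q \<in> U"
    using assms(2) U by (rule sheet_cases) (metis surj_pair)
  show "natural_action e1 e2 (space_over U) z x \<in> space_over U"
    using assms(1) x(2) unfolding z x(1) space_over_eq_sheets[OF U, symmetric]
    by (subst natural_action_sheet) (auto simp: space_over_eq_sheets[OF U] simp del: sheet.simps)
  show "fst (natural_action e1 e2 (space_over U) z x) = fst x"
    using assms x unfolding z x by (simp add: natural_action_sheet del: sheet.simps)
qed

lemma natural_action_add:
  assumes "z \<in> carrier Z2xZ2" "z' \<in> carrier Z2xZ2" "x \<in> space_over U"
  shows "natural_action e1 e2 (space_over U) (z \<otimes>\<^bsub>Z2xZ2\<^esub> z') x =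
    natural_action e1 e2 (space_over U) z (natural_action e1 e2 (space_over U) z' x)"
proof -
  obtain a b a' b' where z: "z = (a, b)" "z' = (a', b')" by (cases z; cases z')
  obtain c d Q where x: "x = sheet (c, d) Q" "Q \<in> U"
    using assms(3) U by (rule sheet_cases) (metis surj_pair)
  have ab: "a \<in> {0, 1}" "b \<in> {0, 1}" "a' \<in> {0, 1}" "b' \<in> {0, 1}"
    using assms(1,2) by (auto simp: z carrier_integer_mod_group)
  then have "((a + a') mod 2, (b + b') mod 2) \<in> carrier Z2xZ2"
    by (auto simp: carrier_integer_mod_group)
  then show ?thesis
    using assms x ab unfolding z x
    by (auto simp: natural_action_sheet simp del: sheet.simps)
qed

lemma group_action_over: "group_action Z2xZ2 (space_over U) (natural_action e1 e2 (space_over U))"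
proof -
  let ?\<phi> = "natural_action e1 e2 (space_over U)"
  have zero: "?\<phi> (0, 0) x = x" if "x \<in> space_over U" for x
    using that by (simp add: natural_action_def)
  have double: "z \<otimes>\<^bsub>Z2xZ2\<^esub> z = (0, 0)" if "z \<in> carrier Z2xZ2" for z
    using that by (auto simp: carrier_integer_mod_group)
  have ext: "?\<phi> z \<in> extensional (space_over U)" for z
    by (cases z) (simp add: natural_action_def)
  have bij: "?\<phi> z \<in> Bij (space_over U)" if z: "z \<in> carrier Z2xZ2" for z
  proof -
    have "?\<phi> z (?\<phi> z x) = x" if "x \<in> space_over U" for x
      using natural_action_add[OF z z that] unfolding double[OF z] zero[OF that] by (rule sym)
    then have "bij_betw (?\<phi> z) (space_over U) (space_over U)"
      using natural_action_in(1)[OF z] by (intro bij_betw_byWitness[where f' = "?\<phi> z"]) auto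
    then show ?thesis
      by (simp add: Bij_def ext)
  qed
  have "?\<phi> (z \<otimes>\<^bsub>Z2xZ2\<^esub> z') = compose (space_over U) (?\<phi> z) (?\<phi> z')"
    if "z \<in> carrier Z2xZ2" "z' \<in> carrier Z2xZ2" for z z'
    by (rule extensionalityI[of _ "space_over U"])
      (simp_all only: ext compose_extensional compose_eq natural_action_add that)
  then have "?\<phi> \<in> hom Z2xZ2 (BijGroup (space_over U))"
    by (intro homI) (simp_all add: BijGroup_def bij del: mult_DirProd')
  then show ?thesis
    by (intro group_action.intro group_hom.intro group_hom_axioms.intro group_BijGroup
        DirProd_group group_integer_mod_group)
qed

lemma continuous_on_natural_action:
  assumes "z \<in> carrier Z2xZ2"
  shows "continuous_on (space_over U) (natural_action e1 e2 (space_over U) z)"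
proof -
  have formula: "continuous_on (space_over U) (\<lambda>x. (fst x, mid_reflection (fst x) ** fst (snd x) ** rho,
      mid_reflection (fst x) ** snd (snd x) ** rho))"
    using U by (intro continuous_intros continuous_on_compose2[OF continuous_on_mid_reflection])
      (auto simp: space_over_def)
  have eq: "reflect e1 e2 x = (fst x, mid_reflection (fst x) ** fst (snd x) ** rho,
      mid_reflection (fst x) ** snd (snd x) ** rho)" if "x \<in> space_over U" for x
    using that U reflect_eq[of "fst x" "fst (snd x)" "snd (snd x)"] by (auto simp: space_over_def Q_space_def)
  have reflect: "continuous_on (space_over U) (reflect e1 e2)"
    by (rule continuous_on_eq[OF formula eq[symmetric]])
  have relabel: "continuous_on S relabel" for S
    unfolding relabel_def case_prod_unfold by (intro continuous_intros)
  obtain a b where z: "z = (a, b)" by (cases z)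
  have "a \<in> {0, 1}" "b \<in> {0, 1}"
    using assms by (auto simp: z carrier_integer_mod_group)
  then have "continuous_on (space_over U) (\<lambda>x. (relabel ^^ nat a) ((reflect e1 e2 ^^ nat b) x))"
    using reflect relabel continuous_on_compose2[OF relabel reflect subset_UNIV]
    by auto
  then show ?thesis
    unfolding z natural_action_def prod.case by simp
qed

lemma natural_action_faithful:
  assumes "Q \<in> U" "inj (\<lambda>i. sheet i Q)"
  shows "inj_on (natural_action e1 e2 (space_over U)) (carrier Z2xZ2)"
proof (rule inj_onI)
  fix z z' assume z: "z \<in> carrier Z2xZ2" "z' \<in> carrier Z2xZ2"
    and eq: "natural_action e1 e2 (space_over U) z = natural_action e1 e2 (space_over U) z'"
  obtain a b a' b' where ab: "z = (a, b)" "z' = (a', b')" by (cases z; cases z')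
  have "sheet (a = 1, b = 1) Q = sheet (a' = 1, b' = 1) Q"
    using eq natural_action_sheet[of a b Q False False] natural_action_sheet[of a' b' Q False False]
      z assms(1) by (simp add: ab del: sheet.simps)
  then have "(a = 1) = (a' = 1)" "(b = 1) = (b' = 1)"
    using assms(2) by (auto dest: injD)
  then show "z = z'"
    using z by (auto simp: ab carrier_integer_mod_group)
qed

lemma natural_action_aristotype:
  assumes "mat 1 \<in> U" "z \<in> carrier Z2xZ2"
  shows "natural_action e1 e2 (space_over U) z (Q_aristotype e1 e2) = Q_aristotype e1 e2"
  using assms natural_action_sheet[of "fst z" "snd z" "mat 1" False False]
  by (simp only: sheet_at_1 prod.collapse)

end

lemma homeomorphic_patch:
  assumes "d > 0"
  shows "cayley ` ball 0 d homeomorphic ball (0 :: real^3) 1"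
proof -
  have "homeomorphism (ball 0 d) (cayley ` ball 0 d) cayley gibbs_vector"
    using homeomorphism_of_subsets[OF cayley_homeomorphism, of "ball 0 d"] by blast
  then show ?thesis
    using assms homeomorphic_balls(1)[of d 1 0 "0 :: real^3"]
    by (meson homeomorphic_def homeomorphic_sym homeomorphic_trans zero_less_one)
qed

theorem covering_and_action:
  assumes "open N" "Q_aristotype e1 e2 \<in> N"
  shows "\<exists>U W. openin (top_of_set SO3) U \<and> mat 1 \<in> U \<and> U homeomorphic ball (0 :: real^3) 1 \<and>
           W = {x \<in> Q_space e1 e2. fst x \<in> U} \<and> Q_aristotype e1 e2 \<in> W \<and> W \<subseteq> N \<and>
           ramified_covering W fst U 4 \<and>
           group_action Z2xZ2 W (natural_action e1 e2 W) \<and>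
           inj_on (natural_action e1 e2 W) (carrier Z2xZ2) \<and>
           (\<forall>g\<in>carrier Z2xZ2.
              continuous_on W (natural_action e1 e2 W g) \<and>
              (\<forall>x\<in>W. fst (natural_action e1 e2 W g x) = fst x) \<and>
              natural_action e1 e2 W g (Q_aristotype e1 e2) = Q_aristotype e1 e2)"
proof -
  obtain d where d: "d > 0" "space_over (cayley ` ball 0 d) \<subseteq> N"
    using small_neighbourhood[OF assms] by blast
  define U where "U = cayley ` ball 0 d"
  have U: "U \<subseteq> cayley_rotations"
    unfolding U_def by (rule cayley_image_subset)
  have 1: "mat 1 \<in> U"
    unfolding U_def using d by (intro image_eqI[of _ _ 0]) auto
  have "ball 0 d \<inter> generic \<noteq> {}"
    using d open_Int_closure_eq_empty[of "ball 0 d" generic] by (auto simp: closure_generic)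
  then obtain g where g: "g \<in> ball 0 d" "g \<in> generic"
    by blast
  define Q where "Q = cayley g"
  have Q: "Q \<in> U" "inj (\<lambda>i. sheet i Q)"
    unfolding Q_def U_def using g(1) by (rule imageI) (rule sheets_distinct[OF g(2)])
  have "sheet (False, False) (mat 1) \<in> space_over U"
    using space_over_eq_sheets[OF U] imageI[OF 1, of "sheet (False, False)"] by blast
  then have aristotype: "Q_aristotype e1 e2 \<in> space_over U"
    by (simp only: sheet_at_1)
  show ?thesis
  proof (intro exI[of _ U] exI[of _ "space_over U"] conjI ballI)
    show "openin (top_of_set SO3) U" "U homeomorphic ball (0 :: real^3) 1"
        "space_over U \<subseteq> N" "ramified_covering (space_over U) fst U 4"
      using openin_cayley_image homeomorphic_patch[OF d(1)] d(2) ramified_covering_over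
      by (simp_all add: U_def)
    show "inj_on (natural_action e1 e2 (space_over U)) (carrier Z2xZ2)"
      by (rule natural_action_faithful[OF U Q])
  qed (simp_all only: 1 aristotype space_over_def[symmetric] group_action_over[OF U]
      continuous_on_natural_action[OF U] natural_action_in(2)[OF U] natural_action_aristotype[OF U 1])
qed

end

section \<open>The singularity at the aristotype\<close>

text \<open>
  The category theorem for finitely many sets, valid in every topological space.
\<close>
lemma open_subset_of_closed_cover:
  assumes "finite F" "openin X W" "W \<noteq> {}" "W \<subseteq> \<Union>F" "\<And>A. A \<in> F \<Longrightarrow> closedin X A"
  shows "\<exists>A\<in>F. \<exists>W'. openin X W' \<and> W' \<noteq> {} \<and> W' \<subseteq> A"
  using assms
proof (induction F arbitrary: W rule: finite_induct)
  case (insert A F)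
  show ?case
  proof (cases "W \<subseteq> A")
    case True
    then show ?thesis
      using insert.prems by blast
  next
    case False
    have "\<exists>A\<in>F. \<exists>W'. openin X W' \<and> W' \<noteq> {} \<and> W' \<subseteq> A"
    proof (rule insert.IH)
      show "openin X (W - A)"
        using insert.prems by (intro openin_diff) auto
    qed (use False insert.prems in auto)
    then show ?thesis
      by blast
  qed
qed simp

text \<open>
  The composite \<open>F \<circ> c\<close> stays in \<open>S\<close> near time 0, so its derivative \<open>D v\<close> is orthogonal to
  the orthogonal complement of \<open>S\<close>, hence in \<open>S\<close>.
\<close>
lemma velocity_in_subspace:
  fixes F :: "'a::euclidean_space \<Rightarrow> 'b::euclidean_space" and c :: "real \<Rightarrow> 'a"
  assumes F: "(F has_derivative D) (at (c 0))"
    and c: "(c has_vector_derivative v) (at 0)"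
    and S: "subspace S" and N: "open N" "c 0 \<in> N" and FS: "\<And>t. c t \<in> N \<Longrightarrow> F (c t) \<in> S"
  shows "D v \<in> S"
proof -
  have "continuous (at 0) c"
    using c has_vector_derivative_continuous by blast
  then obtain T where T: "open T" "0 \<in> T" "\<And>t. t \<in> T \<Longrightarrow> c t \<in> N"
    using N unfolding continuous_at_open by metis
  have Fc: "((\<lambda>t. F (c t)) has_derivative (\<lambda>t. D (t *\<^sub>R v))) (at 0)"
    using diff_chain_at[of c "\<lambda>t. t *\<^sub>R v" 0 F D] F c
    by (simp add: has_vector_derivative_def o_def)
  have "w \<bullet> D v = 0" if w: "w \<in> S\<^sup>\<bottom>" for w
  proof -
    have "((\<lambda>t. w \<bullet> F (c t)) has_derivative (\<lambda>t. w \<bullet> D (t *\<^sub>R v))) (at 0)"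
      by (rule has_derivative_inner_right[OF Fc])
    moreover have "w \<bullet> F (c t) = 0" if "t \<in> T" for t
      using w FS[OF T(3)[OF that]] by (auto simp: orthogonal_comp_def orthogonal_def inner_commute)
    ultimately have "((\<lambda>t. 0) has_derivative (\<lambda>t. w \<bullet> D (t *\<^sub>R v))) (at 0)"
      by (rule has_derivative_transform_within_open[OF _ T(1,2)])
    then have "(\<lambda>t. w \<bullet> D (t *\<^sub>R v)) = (\<lambda>t. 0)"
      by (rule has_derivative_unique) simp
    then show ?thesis
      by (metis scaleR_one)
  qed
  then have "D v \<in> S\<^sup>\<bottom>\<^sup>\<bottom>"
    by (auto simp: orthogonal_comp_def orthogonal_def)
  then show ?thesis
    by (simp add: orthogonal_comp_self S)
qed

lemma bounded_linear_matrix_mult_left: "bounded_linear (\<lambda>A :: real^3^3. A ** B)"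
  unfolding linear_conv_bounded_linear[symmetric]
  by (rule linearI)
    (simp_all add: matrix_matrix_mult_def vec_eq_iff sum_3 algebra_simps)

lemma bounded_linear_matrix_vector: "bounded_linear (\<lambda>A :: real^3^3. A *v x)"
  unfolding linear_conv_bounded_linear[symmetric]
  by (rule linearI)
    (simp_all add: matrix_vector_mult_add_rdistrib scaleR_matrix_vector_assoc)

lemma bounded_linear_entry: "bounded_linear (\<lambda>A :: real^3^3. A $ i $ j)"
  using bounded_linear_compose[OF bounded_linear_vec_nth bounded_linear_vec_nth] .

lemma differentiable_det:
  fixes A :: "'a::real_normed_vector \<Rightarrow> real^3^3"
  assumes "A differentiable at x"
  shows "(\<lambda>x. det (A x)) differentiable at x"
proof -
  have "(\<lambda>x. A x $ i $ j) differentiable at x" for i j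
    using assms bounded_linear.has_derivative[OF bounded_linear_entry]
    unfolding differentiable_def by blast
  then show ?thesis
    unfolding det_3 by (intro differentiable_diff differentiable_add differentiable_mult)
qed

lemma differentiable_gram:
  fixes A :: "'a::real_normed_vector \<Rightarrow> real^3^3"
  assumes "A differentiable at x"
  shows "(\<lambda>x. transpose (A x) ** A x) differentiable at x"
proof -
  have "bilinear (\<lambda>A B :: real^3^3. transpose A ** B)"
    unfolding bilinear_def
    by (auto intro!: linearI simp: transpose_def matrix_matrix_mult_def vec_eq_iff sum_3 algebra_simps)
  then have "bounded_bilinear (\<lambda>A B :: real^3^3. transpose A ** B)"
    by (simp add: bilinear_conv_bounded_bilinear)
  then show ?thesis
    using assms bounded_bilinear.FDERIV unfolding differentiable_def by blast
qed

lemma differentiable_Pair':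
  "f differentiable at x \<Longrightarrow> g differentiable at x \<Longrightarrow> (\<lambda>x. (f x, g x)) differentiable at x"
  unfolding differentiable_def using has_derivative_Pair by blast

lemma differentiable_Q_equations: "Q_equations e1 e2 differentiable at x"
proof -
  have 1: "(\<lambda>x. SO3_equations (A x)) differentiable at x"
    if "A differentiable at x" for A :: "matrix_triple \<Rightarrow> real^3^3"
    unfolding SO3_equations_def
    by (intro differentiable_Pair' differentiable_diff differentiable_const differentiable_gram
        differentiable_det that)
  have 2: "(\<lambda>x. A x *v e) differentiable at x"
    if "A differentiable at x" for A :: "matrix_triple \<Rightarrow> real^3^3" and e
    using that bounded_linear.has_derivative[OF bounded_linear_matrix_vector]
    unfolding differentiable_def by blast
  have 3: "fst differentiable at x" "(\<lambda>x. fst (snd x)) differentiable at x"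
      "(\<lambda>x. snd (snd x)) differentiable at x" for x :: matrix_triple
    by (intro bounded_linear_imp_differentiable bounded_linear_intros)+
  show ?thesis
    unfolding Q_equations_def case_prod_unfold
    by (intro differentiable_Pair' differentiable_diff differentiable_add differentiable_const
        differentiable_minus 1 2 3)
qed

lemma cayley_velocity:
  "((\<lambda>t. cayley (t *\<^sub>R k)) has_vector_derivative 2 *\<^sub>R cross_matrix k) (at 0)"
proof -
  have outer: "matrix (\<lambda>x. (t *\<^sub>R k \<bullet> x) *\<^sub>R t *\<^sub>R k) = (t * t) *\<^sub>R matrix (\<lambda>x. (k \<bullet> x) *\<^sub>R k)" for t
    by (simp add: matrix_def vec_eq_iff)
  have "((\<lambda>t. (1 / (1 + t * (t * (k \<bullet> k)))) *\<^sub>R ((1 - t * (t * (k \<bullet> k))) *\<^sub>R mat 1 +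
      2 *\<^sub>R ((t * t) *\<^sub>R matrix (\<lambda>x. (k \<bullet> x) *\<^sub>R k)) + 2 *\<^sub>R (t *\<^sub>R cross_matrix k)))
      has_vector_derivative 2 *\<^sub>R cross_matrix k) (at 0)"
    unfolding has_vector_derivative_def
    by (auto intro!: derivative_eq_intros simp: algebra_simps)
  then show ?thesis
    unfolding cayley_def outer cross_matrix_scale by (simp only: inner_scaleR_left inner_scaleR_right)
qed

context orthonormal_plane
begin

text \<open>
  The preimages of the four graphs cover \<open>P\<close>, so one of them contains a nonempty open set.  On a graph a
  point is determined by \<open>Q\<close>, and hence by the Gibbs vector in \<open>\<real>\<^sup>3\<close>; invariance of domain applies.
\<close>
lemma dim_sheet_patch_le_3:
  fixes f :: "'b::euclidean_space \<Rightarrow> matrix_triple"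
  assumes L: "subspace L" and P: "openin (top_of_set L) P" "P \<noteq> {}"
    and f: "continuous_on P f" "inj_on f P" "f ` P \<subseteq> space_over cayley_rotations"
  shows "dim L \<le> 3"
proof -
  define A where "A i = {y \<in> P. f y = sheet i (fst (f y))}" for i
  have rot: "fst (f y) \<in> cayley_rotations" "f y \<in> Q_space e1 e2" if "y \<in> P" for y
    using f(3) that unfolding space_over_def by blast+
  have "closedin (top_of_set P) (A i)" for i
    unfolding A_def using rot by (intro closedin_sheet[OF f(1)]) auto
  moreover have "P \<subseteq> \<Union>(range A)"
  proof
    fix y assume y: "y \<in> P"
    then obtain i where "f y = sheet i (fst (f y))"
      using Q_space_fibre rot by blast
    with y have "y \<in> A i"
      unfolding A_def by blast
    then show "y \<in> \<Union>(range A)"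
      by blast
  qed
  ultimately have "\<exists>B\<in>range A. \<exists>W. openin (top_of_set P) W \<and> W \<noteq> {} \<and> W \<subseteq> B"
    using P(2) by (intro open_subset_of_closed_cover[of _ _ P]) auto
  then obtain i W where W: "openin (top_of_set P) W" "W \<noteq> {}" "W \<subseteq> A i"
    by blast
  have WP: "W \<subseteq> P"
    using W(3) unfolding A_def by blast
  let ?h = "\<lambda>y. gibbs_vector (fst (f y))"
  have "dim L \<le> dim (UNIV :: (real^3) set)"
  proof (rule invariance_of_dimension_subspaces)
    show "openin (top_of_set L) W"
      using W(1) P(1) by (rule openin_trans)
    show "continuous_on W ?h"
      using rot WP f(1)
      by (intro continuous_on_compose2[OF homeomorphism_cont2[OF cayley_homeomorphism]]
          continuous_on_fst) (auto intro: continuous_on_subset)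
    show "inj_on ?h W"
    proof (rule inj_onI)
      fix x y assume xy: "x \<in> W" "y \<in> W" "?h x = ?h y"
      then have "fst (f x) = fst (f y)"
        using homeomorphism_apply2[OF cayley_homeomorphism] rot WP by (metis subsetD)
      moreover have "f x = sheet i (fst (f x))" "f y = sheet i (fst (f y))"
        using xy W(3) unfolding A_def by blast+
      ultimately have "f x = f y"
        by metis
      then show "x = y"
        using f(2) xy WP by (meson inj_onD subsetD)
    qed
  qed (use L W(2) in auto)
  then show ?thesis
    by simp
qed

lemma aristotype_neighbourhood:
  obtains N where "open N" "Q_aristotype e1 e2 \<in> N" "Q_space e1 e2 \<inter> N = space_over cayley_rotations"
proof
  let ?N = "{x :: matrix_triple. det (mat 1 + fst x) \<noteq> 0}"
  show "open ?N"
    by (intro open_Collect_neq continuous_intros)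
  show "Q_aristotype e1 e2 \<in> ?N"
    by (simp add: Q_aristotype_def det_3 mat_def)
  show "Q_space e1 e2 \<inter> ?N = space_over cayley_rotations"
    unfolding space_over_def cayley_rotations_def Q_space_def by auto
qed

lemma aristotype_in_Q_space: "Q_aristotype e1 e2 \<in> Q_space e1 e2"
proof -
  have "sheet (False, False) (cayley 0) \<in> Q_space e1 e2"
    by (rule sheet_in_Q_space) (simp only: cayley_rotations_eq_range rangeI)
  then show ?thesis
    by (simp only: cayley_0 sheet_at_1)
qed

lemma local_dim_le_3: "local_dim (Q_space e1 e2) (Q_aristotype e1 e2) \<le> 3"
proof -
  let ?p = "Q_aristotype e1 e2"
  define P where "P d \<longleftrightarrow> (\<forall>N. open N \<and> ?p \<in> N \<longrightarrow>
      (\<exists>S (T :: matrix_triple set). S \<subseteq> Q_space e1 e2 \<inter> N \<and> subspace T \<and> dim T = d \<and> S homeomorphic T))"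
    for d
  have bound: "d \<le> 3" if Pd: "P d" for d
  proof -
    obtain N where N: "open N" "?p \<in> N" "Q_space e1 e2 \<inter> N = space_over cayley_rotations"
      by (rule aristotype_neighbourhood)
    obtain S and T :: "matrix_triple set"
      where S: "S \<subseteq> Q_space e1 e2 \<inter> N" and T: "subspace T" "dim T = d" and "S homeomorphic T"
      using Pd[unfolded P_def, THEN spec, THEN mp, OF conjI[OF N(1,2)]]
      by (elim exE conjE)
    then obtain h h' where h: "homeomorphism S T h h'"
      unfolding homeomorphic_def by (elim exE)
    have "dim T \<le> 3"
    proof (rule dim_sheet_patch_le_3)
      show "openin (top_of_set T) T" "T \<noteq> {}" "subspace T"
        using T subspace_0 by auto
      show "continuous_on T h'"
        by (rule homeomorphism_cont2[OF h])
      show "h' ` T \<subseteq> space_over cayley_rotations"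
        using S unfolding N(3) homeomorphism_image2[OF h] .
      show "inj_on h' T"
        by (rule inj_on_inverseI[of T h]) (rule homeomorphism_apply2[OF h])
    qed
    then show ?thesis
      by (simp add: T)
  qed
  \<comment> \<open>The greatest such dimension exists: the point itself is a cell of dimension 0.\<close>
  have "P 0"
    unfolding P_def
  proof (intro allI impI, elim conjE)
    fix N :: "matrix_triple set" assume "?p \<in> N"
    then have "{?p} \<subseteq> Q_space e1 e2 \<inter> N"
      using aristotype_in_Q_space by simp
    moreover have "{?p} homeomorphic {0 :: matrix_triple}"
      by (simp add: homeomorphic_finite)
    ultimately show "\<exists>S (T :: matrix_triple set). S \<subseteq> Q_space e1 e2 \<inter> N \<and> subspace T \<and> dim T = 0 \<and> S homeomorphic T"
      by (intro exI[of _ "{?p}"] exI[of _ "{0}"]) simp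
  qed
  then have "P (GREATEST d. P d)"
    using bound by (rule GreatestI_nat)
  then show ?thesis
    unfolding local_dim_def P_def[symmetric] by (rule bound)
qed

text \<open>
  The velocity at the aristotype along the sheet \<open>(False, False)\<close> over \<open>cayley (t k)\<close>, plus the one along
  the sheet \<open>(True, False)\<close> over \<open>cayley (t k')\<close>.
\<close>
definition tangent :: "(real^3) \<times> (real^3) \<Rightarrow> matrix_triple" where
  "tangent = (\<lambda>(k, k'). (2 *\<^sub>R cross_matrix k, 0, (2 *\<^sub>R cross_matrix k) ** rho) +
     (2 *\<^sub>R cross_matrix k', (2 *\<^sub>R cross_matrix k') ** rho, 0))"

lemma linear_cross_matrix: "linear cross_matrix"
  by (rule linearI, rule matrix_eqI)
    (simp_all add: cross_matrix_scale cross_matrix_apply cross_add_left matrix_vector_mult_add_rdistrib)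

lemma linear_tangent: "linear tangent"
proof -
  have "linear (\<lambda>A :: real^3^3. A ** rho)"
    by (rule bounded_linear.linear[OF bounded_linear_matrix_mult_left])
  note rmult = linear_add[OF this] linear_scale[OF this]
  show ?thesis
    unfolding tangent_def
    by (rule linearI) (auto simp: linear_add[OF linear_cross_matrix]
        linear_scale[OF linear_cross_matrix] rmult scaleR_add_right mult.commute)
qed

lemma inj_tangent: "inj tangent"
  unfolding linear_injective_0[OF linear_tangent]
proof (intro allI impI)
  have cancel: "k = 0" if "(2 *\<^sub>R cross_matrix k) ** rho = 0" for k
  proof -
    have "(2 *\<^sub>R cross_matrix k) ** rho ** rho = 0"
      using that by (simp add: matrix_matrix_mult_def vec_eq_iff)
    then have "2 *\<^sub>R cross_matrix k = 0"
      by (metis matrix_mul_assoc matrix_mul_rid rho_rho)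
    then have "cross_matrix k = 0"
      by simp
    then show "k = 0"
      using cross_matrix_entries[of k] by (simp add: vec_eq_iff forall_3)
  qed
  fix x assume "tangent x = 0"
  then have "(2 *\<^sub>R cross_matrix (fst x)) ** rho = 0" "(2 *\<^sub>R cross_matrix (snd x)) ** rho = 0"
    unfolding tangent_def case_prod_unfold by (simp_all add: zero_prod_def)
  then show "x = 0"
    using cancel by (metis prod_eq_iff zero_prod_def fst_conv snd_conv)
qed

lemma dim_range_tangent: "dim (range tangent) = 6"
  using dim_image_eq[OF linear_tangent, of UNIV] inj_tangent by simp

text \<open>
  Used twice: with \<open>F\<close> the defining equations and \<open>S = {0}\<close>, and with \<open>F\<close> a flattening diffeomorphism.
\<close>
lemma tangent_in_subspace:
  fixes F :: "matrix_triple \<Rightarrow> 'b::euclidean_space"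
  assumes F: "(F has_derivative D) (at (Q_aristotype e1 e2))"
    and S: "subspace S" and N: "open N" "Q_aristotype e1 e2 \<in> N"
    and FS: "F ` (Q_space e1 e2 \<inter> N) \<subseteq> S"
  shows "D ` range tangent \<subseteq> S"
proof -
  have velocity: "D v \<in> S" if "((\<lambda>t. sheet i (cayley (t *\<^sub>R k))) has_vector_derivative v) (at 0)" for i k v
  proof (rule velocity_in_subspace[OF _ that S N(1)])
    show "(F has_derivative D) (at (sheet i (cayley (0 *\<^sub>R k))))" "sheet i (cayley (0 *\<^sub>R k)) \<in> N"
      using F N by simp_all
    fix t assume "sheet i (cayley (t *\<^sub>R k)) \<in> N"
    then show "F (sheet i (cayley (t *\<^sub>R k))) \<in> S"
      using FS sheet_in_Q_space[of "cayley (t *\<^sub>R k)" i] by (auto simp: cayley_rotations_eq_range)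
  qed
  have rho: "((\<lambda>t. cayley (t *\<^sub>R k) ** rho) has_vector_derivative (2 *\<^sub>R cross_matrix k) ** rho) (at 0)" for k
    by (rule bounded_linear.has_vector_derivative[OF bounded_linear_matrix_mult_left cayley_velocity])
  have 1: "D (2 *\<^sub>R cross_matrix k, 0, (2 *\<^sub>R cross_matrix k) ** rho) \<in> S" for k
    by (rule velocity[of "(False, False)" k], unfold sheet.simps)
      (intro has_vector_derivative_Pair cayley_velocity rho has_vector_derivative_const)
  have 2: "D (2 *\<^sub>R cross_matrix k, (2 *\<^sub>R cross_matrix k) ** rho, 0) \<in> S" for k
    by (rule velocity[of "(True, False)" k], unfold sheet.simps)
      (intro has_vector_derivative_Pair cayley_velocity rho has_vector_derivative_const)
  have "D (tangent x) \<in> S" for x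
    unfolding tangent_def case_prod_unfold linear_add[OF has_derivative_linear[OF F]]
    by (intro subspace_add S 1 2)
  then show ?thesis
    by blast
qed

lemma singular_tangent_space:
  "\<exists>L. (Q_equations e1 e2 has_derivative L) (at (Q_aristotype e1 e2)) \<and>
     local_dim (Q_space e1 e2) (Q_aristotype e1 e2) < dim {h. L h = 0}"
proof -
  obtain L where L: "(Q_equations e1 e2 has_derivative L) (at (Q_aristotype e1 e2))"
    using differentiable_Q_equations unfolding differentiable_def by blast
  have "L ` range tangent \<subseteq> {0}"
    by (rule tangent_in_subspace[OF L, where N = UNIV]) (auto simp: Q_space_eq_zeros)
  then have "dim (range tangent) \<le> dim {h. L h = 0}"
    by (intro dim_subset) auto
  then show ?thesis
    using L local_dim_le_3 by (auto simp: dim_range_tangent)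
qed

text \<open>
  In a flattening chart the subspace \<open>L\<close> contains the image of the 6-dimensional span of tangent vectors under
  an injective derivative, while an open piece of \<open>L\<close> embeds into the union of the sheets.
\<close>
lemma not_smooth: "\<not> smooth_germ (Q_space e1 e2) (Q_aristotype e1 e2)"
proof
  let ?X = "Q_space e1 e2" and ?p = "Q_aristotype e1 e2"
  assume "smooth_germ ?X ?p"
  then obtain N and \<phi> \<psi> :: "matrix_triple \<Rightarrow> matrix_triple" and L
    where N: "open N" "?p \<in> N" "open (\<phi> ` N)" and smooth: "smooth_on N \<phi>" "smooth_on (\<phi> ` N) \<psi>"
      and inverse: "\<And>x. x \<in> N \<Longrightarrow> \<psi> (\<phi> x) = x" and L: "subspace L" "\<phi> ` (?X \<inter> N) = \<phi> ` N \<inter> L"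
    unfolding smooth_germ_def by metis
  have diff: "f differentiable (at x)" if "smooth_on S f" "x \<in> S"
    for f :: "matrix_triple \<Rightarrow> matrix_triple" and S x
    using that by (auto elim: smooth_on.cases)
  obtain D where D: "(\<phi> has_derivative D) (at ?p)"
    using diff[OF smooth(1) N(2)] by (auto simp: differentiable_def)
  obtain E where E: "(\<psi> has_derivative E) (at (\<phi> ?p))"
    using diff[OF smooth(2) imageI[OF N(2)]] by (auto simp: differentiable_def)
  have "(\<psi> \<circ> \<phi> has_derivative E \<circ> D) (at ?p)"
    using diff_chain_at[OF D E] .
  then have "((\<lambda>x. x) has_derivative E \<circ> D) (at ?p)"
    by (rule has_derivative_transform_within_open[OF _ N(1,2)]) (simp add: inverse)
  \<comment> \<open>The chart has a differentiable left inverse, so its derivative is injective.\<close>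
  then have "E \<circ> D = (\<lambda>h. h)"
    by (rule has_derivative_unique[OF _ has_derivative_ident])
  then have "inj D"
    by (metis injI comp_apply)
  then have "dim (D ` range tangent) = 6"
    using dim_image_eq[OF has_derivative_linear[OF D], of "range tangent"]
    by (simp add: dim_range_tangent inj_on_subset)
  moreover have "D ` range tangent \<subseteq> L"
    using L by (intro tangent_in_subspace[OF D L(1) N(1,2)]) auto
  ultimately have "6 \<le> dim L"
    by (metis dim_subset)
  obtain M where M: "open M" "?p \<in> M" "?X \<inter> M = space_over cayley_rotations"
    by (rule aristotype_neighbourhood)
  have cont: "continuous_on (\<phi> ` N) \<psi>"
    using differentiable_imp_continuous_within[OF diff[OF smooth(2)]]
    by (intro continuous_at_imp_continuous_on ballI)
  define P where "P = L \<inter> (\<phi> ` N \<inter> \<psi> -` M)"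
  have P: "\<exists>x. y = \<phi> x \<and> x \<in> ?X \<inter> N \<inter> M" if "y \<in> P" for y
  proof -
    have "y \<in> \<phi> ` (?X \<inter> N)" "\<psi> y \<in> M"
      unfolding L(2) using that by (simp_all add: P_def)
    then obtain x where x: "x \<in> ?X \<inter> N" "y = \<phi> x"
      by (elim imageE)
    with inverse[of x] \<open>\<psi> y \<in> M\<close> show ?thesis
      by (intro exI[of _ x]) simp
  qed
  have "dim L \<le> 3"
  proof (rule dim_sheet_patch_le_3[OF L(1)])
    have "open (\<phi> ` N \<inter> \<psi> -` M)"
      using continuous_open_preimage[OF cont N(3) M(1)] .
    then show "openin (top_of_set L) P"
      unfolding P_def by (rule openin_open_Int)
    have "\<phi> ?p \<in> P"
      using L(2) N(2) M(2) aristotype_in_Q_space inverse[OF N(2)] unfolding P_def by blast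
    then show "P \<noteq> {}"
      by blast
    show "continuous_on P \<psi>"
      using cont by (rule continuous_on_subset) (auto simp: P_def)
    have \<psi>: "\<psi> y \<in> ?X \<inter> M \<and> \<phi> (\<psi> y) = y" if y: "y \<in> P" for y
    proof -
      obtain x where x: "y = \<phi> x" "x \<in> ?X \<inter> N \<inter> M"
        using P[OF y] by (elim exE conjE)
      then have "\<psi> y = x"
        using inverse[of x] by simp
      with x show ?thesis
        by simp
    qed
    show "inj_on \<psi> P"
      by (rule inj_on_inverseI[of _ \<phi>]) (use \<psi> in simp)
    show "\<psi> ` P \<subseteq> space_over cayley_rotations"
      unfolding M(3)[symmetric] using \<psi> by (intro image_subsetI) simp
  qed
  with \<open>6 \<le> dim L\<close> show False
    by simp
qed

end

section \<open>Return to the original coordinates\<close>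

lemma plane_reflection_cong_span:
  assumes "cross3 e1 e2 \<noteq> 0" "cross3 f1 f2 \<noteq> 0" "f1 \<in> span {e1, e2}" "f2 \<in> span {e1, e2}"
  shows "plane_reflection f1 f2 = plane_reflection e1 e2"
proof -
  obtain a b where "f1 - a *\<^sub>R e1 - b *\<^sub>R e2 = 0"
    using assms(3) unfolding span_breakdown_eq span_empty singleton_iff by (elim exE)
  then have f1: "f1 = a *\<^sub>R e1 + b *\<^sub>R e2"
    by (simp add: algebra_simps)
  obtain c d where "f2 - c *\<^sub>R e1 - d *\<^sub>R e2 = 0"
    using assms(4) unfolding span_breakdown_eq span_empty singleton_iff by (elim exE)
  then have f2: "f2 = c *\<^sub>R e1 + d *\<^sub>R e2"
    by (simp add: algebra_simps)
  have "cross3 f1 f2 = (a * d - b * c) *\<^sub>R cross3 e1 e2"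
    unfolding f1 f2 by (simp add: cross3_simps)
  with assms(2) show ?thesis
    by (metis plane_reflection_eq reflection_scale scale_eq_0_iff)
qed

lemma regular_tetrahedron_face_independent:
  assumes "regular_tetrahedron 0 f0 f1 f2"
  shows "cross3 f1 f2 \<noteq> 0"
proof -
  obtain l where l: "l > 0" "norm f1 = l" "norm f2 = l" "dist f1 f2 = l"
    using assms unfolding regular_tetrahedron_def dist_0_norm by (elim exE conjE)
  then have "f1 \<bullet> f1 = l * l" "f2 \<bullet> f2 = l * l" "(f1 - f2) \<bullet> (f1 - f2) = l * l"
    by (simp_all add: dist_norm flip: power2_norm_eq_inner power2_eq_square)
  then have "f1 \<bullet> f1 = l * l" "f2 \<bullet> f2 = l * l" "2 * (f1 \<bullet> f2) = l * l"
    by (simp_all add: algebra_simps inner_commute)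
  moreover have "cross3 f1 f2 \<bullet> cross3 f1 f2 = (f1 \<bullet> f1) * (f2 \<bullet> f2) - (f1 \<bullet> f2) * (f1 \<bullet> f2)"
    by (simp add: cross3_simps)
  ultimately have "4 * (cross3 f1 f2 \<bullet> cross3 f1 f2) = 3 * (l * l) * (l * l)"
    by algebra
  with l(1) show ?thesis
    by auto
qed

lemma matrix_mult_uminus: "A ** - B = - (A ** B)" "- A ** B = - (A ** B)" for A B :: "real^3^3"
  by (simp_all add: matrix_matrix_mult_def vec_eq_iff sum_negf)

lemma vanish_on_span_iff:
  fixes M :: "real^3^3"
  assumes "span A = span B"
  shows "(\<forall>x\<in>A. M *v x = 0) \<longleftrightarrow> (\<forall>x\<in>B. M *v x = 0)"
proof -
  have "subspace {x. M *v x = 0}"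
    using linear_subspace_kernel[OF matrix_vector_mul_linear[of M]] .
  then have "C \<subseteq> {x. M *v x = 0} \<longleftrightarrow> span C \<subseteq> {x. M *v x = 0}" for C
    using span_minimal[of C] span_superset[of C] by blast
  from this[of A] this[of B] assms have "A \<subseteq> {x. M *v x = 0} \<longleftrightarrow> B \<subseteq> {x. M *v x = 0}"
    by simp
  then show ?thesis
    by (simp only: subset_iff mem_Collect_eq Ball_def)
qed

context orthonormal_plane
begin

text \<open>
  The change of coordinates is defined on all orthogonal triples; negative determinants select,
  among the eight components of the group of orthogonal triples, the one of the aristotype.
\<close>
lemma homeomorphism_to_Q:
  assumes "span {e1, e2} = span {f1, f2}"
  defines "N \<equiv> {(R0 :: real^3^3, R1 :: real^3^3, R2 :: real^3^3). det R0 < 0 \<and> det R1 < 0 \<and> det R2 < 0}"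
  shows "homeomorphism (deformation_space f0 f1 f2 \<inter> N) (Q_space e1 e2) to_Q from_Q"
proof -
  have relations: "(\<forall>e\<in>{e1, e2}. e + Q *v e = Q1 *v e + Q2 *v e) \<longleftrightarrow>
      (\<forall>f\<in>{f1, f2}. (mat 1 + Q - Q1 - Q2) *v f = 0)" for Q Q1 Q2
  proof -
    have "e + Q *v e = Q1 *v e + Q2 *v e \<longleftrightarrow> (mat 1 + Q - Q1 - Q2) *v e = 0" for e
      by (simp add: matrix_vector_mult_add_rdistrib matrix_vector_mult_diff_rdistrib diff_diff_eq)
    then show ?thesis
      using vanish_on_span_iff[OF assms(1)] by simp
  qed
  have det: "orthogonal_matrix R \<and> det R < 0 \<longleftrightarrow> - R \<in> SO3" for R
    using det_orthogonal_matrix[of R] by (auto simp: uminus_SO3_iff)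
  have domain: "(R0, R1, R2) \<in> deformation_space f0 f1 f2 \<inter> N \<longleftrightarrow>
      - R0 \<in> SO3 \<and> - R1 \<in> SO3 \<and> - R2 \<in> SO3 \<and> (\<forall>f\<in>{f1, f2}. (mat 1 - R0 - R1 + R2 ** R0) *v f = 0)"
    for R0 R1 R2
    unfolding deformation_space_eq N_def det[symmetric] by auto
  have codomain: "(Q, Q1, Q2) \<in> Q_space e1 e2 \<longleftrightarrow> Q \<in> SO3 \<and> - Q1 \<in> SO3 \<and> - Q2 \<in> SO3 \<and>
      (\<forall>f\<in>{f1, f2}. (mat 1 + Q - Q1 - Q2) *v f = 0)" for Q Q1 Q2
    unfolding Q_space_def relations by simp
  have forward: "to_Q x \<in> Q_space e1 e2 \<and> from_Q (to_Q x) = x" if "x \<in> deformation_space f0 f1 f2 \<inter> N" for x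
  proof -
    obtain R0 R1 R2 where x: "x = (R0, R1, R2)"
      by (cases x)
    have R: "- R0 \<in> SO3" "- R1 \<in> SO3" "- R2 \<in> SO3"
        "\<forall>f\<in>{f1, f2}. (mat 1 - R0 - R1 + R2 ** R0) *v f = 0"
      using that unfolding x domain by blast+
    have "R2 ** R0 ** transpose R0 = R2"
      using R(1) by (simp add: uminus_SO3_iff orthogonal_matrix_def flip: matrix_mul_assoc)
    moreover have "transpose (- R0) = - transpose R0"
      by (simp add: transpose_def vec_eq_iff)
    moreover have "R2 ** R0 \<in> SO3"
      using R by (simp add: improper_mult_improper)
    ultimately show ?thesis
      using R unfolding x to_Q_def from_Q_def prod.case codomain by (simp add: matrix_mult_uminus)
  qed
  have backward: "from_Q x \<in> deformation_space f0 f1 f2 \<inter> N \<and> to_Q (from_Q x) = x" if "x \<in> Q_space e1 e2" for x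
  proof -
    obtain Q Q1 Q2 where x: "x = (Q, Q1, Q2)"
      by (cases x)
    have Q: "Q \<in> SO3" "- Q1 \<in> SO3" "- Q2 \<in> SO3" "\<forall>f\<in>{f1, f2}. (mat 1 + Q - Q1 - Q2) *v f = 0"
      using that unfolding x codomain by blast+
    have "Q2 ** transpose Q ** Q = Q2"
      using Q(1) by (simp add: SO3_transpose_mult flip: matrix_mul_assoc)
    moreover have "transpose Q \<in> SO3"
      using Q(1) by (simp add: SO3_def det_transpose)
    then have "- (Q2 ** transpose Q) \<in> SO3"
      using Q by (simp add: improper_mult_SO3)
    ultimately show ?thesis
      using Q unfolding x to_Q_def from_Q_def prod.case domain by (simp add: matrix_mult_uminus)
  qed
  show ?thesis
  proof (rule homeomorphismI)
    show "continuous_on (deformation_space f0 f1 f2 \<inter> N) to_Q" "continuous_on (Q_space e1 e2) from_Q"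
      unfolding to_Q_def from_Q_def case_prod_unfold by (intro continuous_intros)+
    show "to_Q ` (deformation_space f0 f1 f2 \<inter> N) \<subseteq> Q_space e1 e2"
      by (rule image_subsetI) (rule conjunct1[OF forward])
    show "from_Q ` Q_space e1 e2 \<subseteq> deformation_space f0 f1 f2 \<inter> N"
      by (rule image_subsetI) (rule conjunct1[OF backward])
  qed (rule conjunct2[OF forward] conjunct2[OF backward], assumption)+
qed

lemma deformation_space_near_aristotype:
  assumes span: "span {e1, e2} = span {f1, f2}" and f: "cross3 f1 f2 \<noteq> 0"
  shows "\<exists>N. open N \<and> aristotype f1 f2 \<in> N \<and>
        homeomorphism (deformation_space f0 f1 f2 \<inter> N) (Q_space e1 e2) to_Q from_Q"
    and "aristotype f1 f2 \<in> deformation_space f0 f1 f2"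
    and "to_Q (aristotype f1 f2) = Q_aristotype e1 e2"
proof -
  have rho: "plane_reflection f1 f2 = rho"
    using plane_reflection_cong_span[of e1 e2 f1 f2] f span span_base[of _ "{f1, f2}"] by simp
  have minus_rho: "rho ** - mat 1 = - rho"
    by (simp add: matrix_mult_uminus)
  let ?N = "{(R0 :: real^3^3, R1 :: real^3^3, R2 :: real^3^3). det R0 < 0 \<and> det R1 < 0 \<and> det R2 < 0}"
  have "open ?N"
    unfolding case_prod_unfold by (intro open_Collect_conj open_Collect_less continuous_intros)
  moreover have "aristotype f1 f2 \<in> ?N"
    using rho_improper by (simp add: aristotype_def rho uminus_SO3_iff det_uminus_3)
  ultimately show "\<exists>N. open N \<and> aristotype f1 f2 \<in> N \<and>
        homeomorphism (deformation_space f0 f1 f2 \<inter> N) (Q_space e1 e2) to_Q from_Q"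
    using homeomorphism_to_Q[OF span] by (intro exI[of _ ?N] conjI)
  have fixed: "rho *v f1 = f1" "rho *v f2 = f2"
    unfolding rho[symmetric] unfolding plane_reflection_eq
    by (simp_all add: reflection_fixes dot_cross_self)
  have "orthogonal_matrix rho"
    using rho_improper by (simp add: uminus_SO3_iff)
  then show "aristotype f1 f2 \<in> deformation_space f0 f1 f2"
    unfolding deformation_space_eq aristotype_def rho
    by (simp add: minus_rho fixed matrix_vector_mult_add_rdistrib matrix_vector_mult_diff_rdistrib
        uminus_matrix_vector_mult orthogonal_matrix_id)
  show "to_Q (aristotype f1 f2) = Q_aristotype e1 e2"
    by (simp add: to_Q_def aristotype_def Q_aristotype_def rho minus_rho)
qed

end

section \<open>The deformation space of the ideal tridymite framework\<close>

theorem theorem3: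
  fixes f0 f1 f2 e1 e2 :: "real^3"
  assumes tetrahedron: "regular_tetrahedron 0 f0 f1 f2"
    and orthonormal: "norm e1 = 1" "norm e2 = 1" "e1 \<bullet> e2 = 0"
    and basis: "span {e1, e2} = span {f1, f2}"
  shows
    \<comment> \<open>near the aristotype, the deformation space is \<open>Q_space\<close> in other coordinates\<close>
    "(\<exists>N. open N \<and> aristotype f1 f2 \<in> N \<and>
        homeomorphism (deformation_space f0 f1 f2 \<inter> N) (Q_space e1 e2) to_Q from_Q) \<and>
     aristotype f1 f2 \<in> deformation_space f0 f1 f2 \<and>
     to_Q (aristotype f1 f2) = Q_aristotype e1 e2 \<and>
     \<comment> \<open>singularity at the aristotype\<close>
     \<not> smooth_germ (Q_space e1 e2) (Q_aristotype e1 e2) \<and>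
     (\<exists>L. (Q_equations e1 e2 has_derivative L) (at (Q_aristotype e1 e2)) \<and>
        local_dim (Q_space e1 e2) (Q_aristotype e1 e2) < dim {h. L h = 0}) \<and>
     \<comment> \<open>in arbitrarily small neighbourhoods \<open>W\<close> of the aristotype: ramified covering and action\<close>
     (\<forall>N. open N \<and> Q_aristotype e1 e2 \<in> N \<longrightarrow>
        (\<exists>U W. openin (top_of_set SO3) U \<and> mat 1 \<in> U \<and> U homeomorphic ball (0 :: real^3) 1 \<and>
           W = {x \<in> Q_space e1 e2. fst x \<in> U} \<and> Q_aristotype e1 e2 \<in> W \<and> W \<subseteq> N \<and>
           ramified_covering W fst U 4 \<and>
           group_action Z2xZ2 W (natural_action e1 e2 W) \<and>
           inj_on (natural_action e1 e2 W) (carrier Z2xZ2) \<and>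
           (\<forall>g\<in>carrier Z2xZ2.
              continuous_on W (natural_action e1 e2 W g) \<and>
              (\<forall>x\<in>W. fst (natural_action e1 e2 W g x) = fst x) \<and>
              natural_action e1 e2 W g (Q_aristotype e1 e2) = Q_aristotype e1 e2)))"
proof -
  interpret orthonormal_plane e1 e2
    by unfold_locales (use orthonormal in \<open>simp add: orthonormal_pair_def dot_square_norm\<close>)
  have "cross3 f1 f2 \<noteq> 0"
    using tetrahedron by (rule regular_tetrahedron_face_independent)
  note near = deformation_space_near_aristotype[OF basis this]
  show ?thesis
    by (intro conjI allI impI; (rule near not_smooth singular_tangent_space | elim conjE, rule covering_and_action; assumption))
qed

end
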